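(* Let $A\in L(X_1;X_2)$ be a bounded complex-linear operator, let $\mathcal E_1$ be a generating set for the $\mathbb R$-cone $K_{\mathbb R,1}\subset X_{\mathbb R,1}$ and let $\mathcal M_2$ be a weak-$*$ generating set for the dual cone $K'_{\mathbb R,2}$ of the $\mathbb R$-cone $K_{\mathbb R,2}\subset X_{\mathbb R,2}$. Let $\mathcal T(A)\subset M_2(\mathbb C)$ be the collection of all matrices $$\begin{pmatrix}\langle m_1,Ae_1\rangle & \langle m_2,Ae_1\rangle\\ \langle m_1,Ae_2\rangle & \langle m_2,Ae_2\rangle\end{pmatrix},\qquad e_1,e_2\in\mathcal E_1,\ m_1,m_2\in\mathcal M_2 .$$ Then $\mathcal T(A)\subset\overline{\Gamma}_+$ if and only if both $A(K_{\mathbb C,1})\subset K_{\mathbb C,2}$ and $A'(K'_{\mathbb C,2})\subset K'_{\mathbb C,1}$, where $A':X_2'\to X_1'$ is the transposed operator.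
   Context: For $i=1,2$, $X_{\mathbb R,i}$ is a real Banach space and $X_i=X_{\mathbb R,i}\oplus iX_{\mathbb R,i}$ is a complexification of it (a complex Banach space containing $X_{\mathbb R,i}$ as a closed real subspace with the restricted norm). $X'_{\mathbb R,i}$, $X'_i$ are the topological duals, $\langle\cdot,\cdot\rangle$ the canonical (bilinear) dualities, and real functionals are extended complex-linearly to $X_i$. An $\mathbb R$-cone $K_{\mathbb R}$ in a real Banach space $X_{\mathbb R}$ is a closed subset with $K_{\mathbb R}+K_{\mathbb R}=K_{\mathbb R}$, $\mathbb R_+K_{\mathbb R}=K_{\mathbb R}$, $K_{\mathbb R}\cap -K_{\mathbb R}=\{0\}$. Its dual cone is $K'_{\mathbb R}=\{\ell\in X'_{\mathbb R}:\langle\ell,x\rangle\ge 0\ \forall x\in K_{\mathbb R}\}$. Its canonical complexification and the complexified dual cone are $$K_{\mathbb C}=\{x\in X:\operatorname{Re}\langle\ell_1,x\rangle\overline{\langle\ell_2,x\rangle}\ge 0\ \ \forall\ell_1,\ell_2\in K'_{\mathbb R}\},\qquad K'_{\mathbb C}=\{\mu\in X':\operatorname{Re}\langle\mu,x_1\rangle\overline{\langle\mu,x_2\rangle}\ge 0\ \ \forall x_1,x_2\in K_{\mathbb R}\}.$$ $K_{\mathbb C,i}$, $K'_{\mathbb C,i}$ are these sets for $K_{\mathbb R,i}$. For a set $S$, $\mathbb R_+(S)$ is the set of finite sums $\sum t_ku_k$, $t_k\ge 0$, $u_k\in S$. A generating set $\mathcal E_1$ for $K_{\mathbb R,1}$ is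 a subset of $K_{\mathbb R,1}\setminus\{0\}$ with $K_{\mathbb R,1}=\overline{\mathbb R_+(\mathcal E_1)}$. A weak-$*$ generating set $\mathcal M_2$ for $K'_{\mathbb R,2}$ is a subset of $K'_{\mathbb R,2}\setminus\{0\}$ such that for every $\mu\in K'_{\mathbb R,2}$, all $y_1,\dots,y_p\in X_2$ and $\epsilon>0$ there is $\ell\in\mathbb R_+(\mathcal M_2)$ with $|\langle\ell,y_k\rangle-\langle\mu,y_k\rangle|<\epsilon$, $k=1,\dots,p$. Finally $$\overline\Gamma_+=\left\{\begin{pmatrix}a&b\\c&d\end{pmatrix}\in M_2(\mathbb C):|ad-bc|\le\operatorname{Re}(a\bar d+b\bar c),\ \operatorname{Re}a\bar b,\ \operatorname{Re}a\bar c,\ \operatorname{Re}b\bar d,\ \operatorname{Re}c\bar d\ \ge 0\right\}.$$ *)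

theory Defs
  imports "HOL-Analysis.Analysis"
begin

class scaleC =
  fixes scaleC :: "complex \<Rightarrow> 'a \<Rightarrow> 'a"  (infixr "*\<^sub>C" 75)

class complex_normed_vector = real_normed_vector + scaleC +
  assumes scaleC_add_right: "c *\<^sub>C (x + y) = c *\<^sub>C x + c *\<^sub>C y"
    and scaleC_add_left: "(c + d) *\<^sub>C x = c *\<^sub>C x + d *\<^sub>C x"
    and scaleC_scaleC: "c *\<^sub>C d *\<^sub>C x = (c * d) *\<^sub>C x"
    and scaleC_one: "1 *\<^sub>C x = x"
    and scaleR_scaleC: "r *\<^sub>R x = complex_of_real r *\<^sub>C x"
    and norm_scaleC: "norm (c *\<^sub>C x) = cmod c * norm x"

class complex_banach = complex_normed_vector + banach

instantiation complex :: complex_banach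
begin

definition scaleC_complex :: "complex \<Rightarrow> complex \<Rightarrow> complex" where
  "scaleC_complex c z = c * z"

instance
  by standard (auto simp: scaleC_complex_def algebra_simps norm_mult scaleR_conv_of_real)

end

text \<open>The library type \<open>'a \<Rightarrow>\<^sub>L 'b\<close> consists of the bounded \<^emph>\<open>real\<close>-linear operators.\<close>

definition complex_operators ::
  "('a::complex_normed_vector \<Rightarrow>\<^sub>L 'b::complex_normed_vector) set" where
  "complex_operators = {A. \<forall>c x. blinfun_apply A (c *\<^sub>C x) = c *\<^sub>C blinfun_apply A x}"

abbreviation complex_dual :: "('a::complex_normed_vector \<Rightarrow>\<^sub>L complex) set" where
  "complex_dual \<equiv> complex_operators"

definition transposed ::
  "('a::complex_normed_vector \<Rightarrow>\<^sub>L 'b::complex_normed_vector) \<Rightarrow>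
    ('b \<Rightarrow>\<^sub>L complex) \<Rightarrow> ('a \<Rightarrow>\<^sub>L complex)" where
  "transposed A \<mu> = \<mu> o\<^sub>L A"

definition real_imag_sum :: "('r::banach \<Rightarrow> 'x::complex_banach) \<Rightarrow> 'r \<times> 'r \<Rightarrow> 'x" where
  "real_imag_sum J = (\<lambda>(a, b). J a + \<i> *\<^sub>C J b)"

text \<open>The inclusion of the real Banach space into its complexification is an explicit isometric
  embedding \<open>J\<close>; the range of \<open>J\<close> is closed because \<open>'r\<close> is complete. The direct sum is algebraic,
  and no condition is imposed on the norm off the range of \<open>J\<close>, except that it is a complete
  complex norm.\<close>

definition complexification :: "('r::banach \<Rightarrow> 'x::complex_banach) \<Rightarrow> bool" where
  "complexification J \<longleftrightarrow>
     linear J \<and> (\<forall>a. norm (J a) = norm a) \<and> bij (real_imag_sum J)"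

definition complex_extension ::
  "('r::banach \<Rightarrow> 'x::complex_banach) \<Rightarrow> ('r \<Rightarrow>\<^sub>L real) \<Rightarrow> 'x \<Rightarrow> complex" where
  "complex_extension J l x =
     (case inv (real_imag_sum J) x of (a, b) \<Rightarrow>
        complex_of_real (blinfun_apply l a) + \<i> * complex_of_real (blinfun_apply l b))"

lemma complex_extension_eq:
  assumes "complexification J"
  shows "complex_extension J l (J a + \<i> *\<^sub>C J b) =
           complex_of_real (blinfun_apply l a) + \<i> * complex_of_real (blinfun_apply l b)"
proof -
  have "inj (real_imag_sum J)"
    using assms by (auto simp: complexification_def bij_def)
  then have "inv (real_imag_sum J) (real_imag_sum J (a, b)) = (a, b)"
    by (rule inv_f_f)
  then show ?thesis
    by (simp add: complex_extension_def real_imag_sum_def)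
qed

lemma complexification_of_real: "complexification complex_of_real"
proof -
  have "inj (real_imag_sum complex_of_real)"
    by (auto simp: inj_on_def real_imag_sum_def scaleC_complex_def complex_eq_iff)
  moreover have "z = real_imag_sum complex_of_real (Re z, Im z)" for z
    by (simp add: real_imag_sum_def scaleC_complex_def complex_eq_iff)
  ultimately show ?thesis
    unfolding complexification_def bij_def
    by (auto intro!: bounded_linear.linear bounded_linear_of_real)
qed

definition real_cone :: "'r::banach set \<Rightarrow> bool" where
  "real_cone K \<longleftrightarrow> closed K \<and>
     {x + y | x y. x \<in> K \<and> y \<in> K} = K \<and>
     {t *\<^sub>R x | t x. 0 \<le> t \<and> x \<in> K} = K \<and>
     K \<inter> uminus ` K = {0}"

definition dual_cone :: "'r::banach set \<Rightarrow> ('r \<Rightarrow>\<^sub>L real) set" where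
  "dual_cone K = {l. \<forall>x\<in>K. 0 \<le> blinfun_apply l x}"

definition complexified_cone ::
  "('r::banach \<Rightarrow> 'x::complex_banach) \<Rightarrow> 'r set \<Rightarrow> 'x set" where
  "complexified_cone J K = {x. \<forall>l1\<in>dual_cone K. \<forall>l2\<in>dual_cone K.
     0 \<le> Re (complex_extension J l1 x * cnj (complex_extension J l2 x))}"

definition complexified_dual_cone ::
  "('r::banach \<Rightarrow> 'x::complex_banach) \<Rightarrow> 'r set \<Rightarrow> ('x \<Rightarrow>\<^sub>L complex) set" where
  "complexified_dual_cone J K = {\<mu> \<in> complex_dual. \<forall>x1\<in>K. \<forall>x2\<in>K.
     0 \<le> Re (blinfun_apply \<mu> (J x1) * cnj (blinfun_apply \<mu> (J x2)))}"

text \<open>The empty sum is allowed, so that the empty set generates the cone \<open>{0}\<close>.\<close>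

definition nonneg_combinations :: "'v::real_vector set \<Rightarrow> 'v set" where
  "nonneg_combinations S =
     {\<Sum>u\<in>F. t u *\<^sub>R u | F t. finite F \<and> F \<subseteq> S \<and> (\<forall>u\<in>F. (0::real) \<le> t u)}"

definition generating_set :: "'r::banach set \<Rightarrow> 'r set \<Rightarrow> bool" where
  "generating_set K E \<longleftrightarrow> E \<subseteq> K - {0} \<and> K = closure (nonneg_combinations E)"

definition weak_star_generating_set ::
  "('r::banach \<Rightarrow> 'x::complex_banach) \<Rightarrow> 'r set \<Rightarrow> ('r \<Rightarrow>\<^sub>L real) set \<Rightarrow> bool" where
  "weak_star_generating_set J K M \<longleftrightarrow> M \<subseteq> dual_cone K - {0} \<and>
     (\<forall>\<mu>\<in>dual_cone K. \<forall>Y \<epsilon>. finite Y \<and> 0 < \<epsilon> \<longrightarrow>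
        (\<exists>l\<in>nonneg_combinations M. \<forall>y\<in>Y.
           cmod (complex_extension J l y - complex_extension J \<mu> y) < \<epsilon>))"

definition matrix2 :: "complex \<Rightarrow> complex \<Rightarrow> complex \<Rightarrow> complex \<Rightarrow> complex^2^2" where
  "matrix2 a b c d = vector [vector [a, b], vector [c, d]]"

definition Gamma_plus_closed :: "(complex^2^2) set" where
  "Gamma_plus_closed = {matrix2 a b c d | a b c d.
     cmod (a * d - b * c) \<le> Re (a * cnj d + b * cnj c) \<and>
     0 \<le> Re (a * cnj b) \<and> 0 \<le> Re (a * cnj c) \<and>
     0 \<le> Re (b * cnj d) \<and> 0 \<le> Re (c * cnj d)}"

definition test_matrices ::
  "('r1::banach \<Rightarrow> 'x1::complex_banach) \<Rightarrow> ('r2::banach \<Rightarrow> 'x2::complex_banach) \<Rightarrow>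
    'r1 set \<Rightarrow> ('r2 \<Rightarrow>\<^sub>L real) set \<Rightarrow> ('x1 \<Rightarrow>\<^sub>L 'x2) \<Rightarrow> (complex^2^2) set" where
  "test_matrices J1 J2 E M A =
     {matrix2
        (complex_extension J2 m1 (blinfun_apply A (J1 e1)))
        (complex_extension J2 m2 (blinfun_apply A (J1 e1)))
        (complex_extension J2 m1 (blinfun_apply A (J1 e2)))
        (complex_extension J2 m2 (blinfun_apply A (J1 e2)))
      | e1 e2 m1 m2. e1 \<in> E \<and> e2 \<in> E \<and> m1 \<in> M \<and> m2 \<in> M}"

end

theory Submission
  imports Defs
begin

text \<open>The condition under test is about \<open>2 \<times> 2\<close> matrices with entries \<open>\<langle>m, A e\<rangle>\<close>, and the whole argument
  rests on what \<open>\<Gamma>\<close>, the closed matrix set of the theorem, means for the cone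
  \<open>C = {(u, v). Re (u * cnj v) \<ge> 0}\<close> in \<open>\<complex>\<^sup>2\<close>, the complexification of the positive quadrant.
  A matrix is in \<open>\<Gamma>\<close> exactly when it maps \<open>C\<close> into itself and both its rows lie in \<open>C\<close>
  (\<open>gamma_plus_preserves\<close>, \<open>gamma_plusI\<close>). Since \<open>\<Gamma>\<close> is stable under transposition, the same
  holds with rows and columns exchanged.

  For a fixed \<open>(u, v)\<close>, invariance of \<open>C\<close> is a condition on the two
  numbers obtained by pairing the rows with \<open>(u, v)\<close>, and \<open>Re (z * cnj w) \<ge> 0\<close> is additive in
  \<open>z\<close> and in \<open>w\<close>. Therefore, if all pairs from a family of rows form matrices in \<open>\<Gamma>\<close>, so do all pairs
  of nonnegative combinations of these rows (\<open>gamma_plus_sum_rows\<close>), and by transposition the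
  same is true for columns. With a passage to the limit, membership in \<open>\<Gamma>\<close> spreads from the two
  generating sets to all vectors of \<open>K1\<close> and all functionals of the dual cone of \<open>K2\<close>
  (\<open>gamma_plus_extends_to_cones\<close>).

  A set of complex numbers that are pairwise at an angle of at most
  \<open>\<pi>/2\<close> can be rotated into the first quadrant. Hence every element of the complexified cone is a
  complex multiple of \<open>u + \<i> v\<close> with \<open>u, v\<close> in the real cone (\<open>complexified_cone_rotation\<close>), and
  every element of the complexified dual cone is a multiple of \<open>m1 + \<i> m2\<close> with real functionals
  from the dual cone (\<open>complexified_dual_cone_rotation\<close>). Applying \<open>A\<close>, or its transpose, to such an
  element amounts to applying a test matrix, transposed or not, to the vector \<open>(1, \<i>)\<close> of \<open>C\<close>; so the
  matrix condition implies both inclusions. Conversely, \<open>u e1 + v e2\<close> lies in the complexified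
  cone whenever \<open>(u, v)\<close> is in \<open>C\<close> and \<open>e1, e2\<close> are in the real cone. Thus the inclusion for \<open>A\<close> says
  that the transposed test matrices leave \<open>C\<close> invariant, while the inclusion for the transpose,
  applied to the real functionals, puts their rows into \<open>C\<close>.

  Two theorems of functional analysis enter. The Hahn-Banach theorem shows that a closed convex
  cone is determined by its dual cone, which identifies the rotated real and imaginary parts as
  elements of \<open>K\<close>. The bounded inverse theorem shows that the complex extension of a real
  functional is continuous, although the norm of a complexification is not tied to the norms of
  real and imaginary parts.\<close>

section \<open>Two-by-two matrices and the complexified quadrant\<close>

definition gamma_plus :: "complex \<Rightarrow> complex \<Rightarrow> complex \<Rightarrow> complex \<Rightarrow> bool" where
  "gamma_plus a b c d \<longleftrightarrow>
     cmod (a * d - b * c) \<le> Re (a * cnj d + b * cnj c) \<and>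
     0 \<le> Re (a * cnj b) \<and> 0 \<le> Re (a * cnj c) \<and>
     0 \<le> Re (b * cnj d) \<and> 0 \<le> Re (c * cnj d)"

lemma matrix2_eq_iff:
  "matrix2 a b c d = matrix2 a' b' c' d' \<longleftrightarrow> a = a' \<and> b = b' \<and> c = c' \<and> d = d'"
  unfolding matrix2_def by (metis vector_2)

lemma matrix2_in_Gamma_plus_closed: "matrix2 a b c d \<in> Gamma_plus_closed \<longleftrightarrow> gamma_plus a b c d"
  unfolding Gamma_plus_closed_def gamma_plus_def by (auto simp: matrix2_eq_iff)

lemma gamma_plus_transpose: "gamma_plus a b c d \<Longrightarrow> gamma_plus a c b d"
proof -
  have "Re (a * cnj d + b * cnj c) = Re (a * cnj d + c * cnj b)"
    by (simp add: mult.commute)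
  then show "gamma_plus a b c d \<Longrightarrow> gamma_plus a c b d"
    unfolding gamma_plus_def by (simp only: mult.commute[of b c])
qed

text \<open>With \<open>x\<close> and \<open>y\<close> the two quantities squared on the left, the determinant bound \<open>|a d - b c| \<le> x\<close>
  becomes \<open>y\<^sup>2 \<le> 4 Re (a * cnj c) Re (b * cnj d)\<close> together with \<open>x \<ge> 0\<close>: a discriminant
  condition for the quadratic form in the next lemma.\<close>

lemma gamma_plus_identity:
  "(Re (a * cnj d + b * cnj c))\<^sup>2 + (Im (a * cnj d + cnj b * c))\<^sup>2 =
     (cmod (a * d - b * c))\<^sup>2 + 4 * Re (a * cnj c) * Re (b * cnj d)"
  unfolding cmod_power2 by (simp add: power2_eq_square algebra_simps)

lemma Re_image_mult_cnj:
  "Re ((a * u + b * v) * cnj (c * u + d * v)) =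
     (cmod u)\<^sup>2 * Re (a * cnj c) + (cmod v)\<^sup>2 * Re (b * cnj d)
     + (Re (a * cnj d + b * cnj c) * Re (u * cnj v) - Im (a * cnj d + cnj b * c) * Im (u * cnj v))"
  unfolding cmod_power2 by (simp add: power2_eq_square algebra_simps)

text \<open>Only the values on the quadrant \<open>s, t \<ge> 0\<close> are given; they suffice because a negative mixed
  coefficient makes the minimum of the form occur there.\<close>

lemma nonneg_quadratic_form_discriminant:
  fixes P Q y :: real
  assumes "0 \<le> P" "0 \<le> Q" "y < 0"
    and form: "\<And>s t. 0 \<le> s \<Longrightarrow> 0 \<le> t \<Longrightarrow> 0 \<le> s\<^sup>2 * P + t\<^sup>2 * Q + s * t * y"
  shows "y\<^sup>2 \<le> 4 * P * Q"
proof (cases "Q = 0")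
  case True
  \<comment> \<open>\<open>s = 1\<close> and \<open>t\<close> so large that the mixed term outweighs \<open>P\<close>\<close>
  have "0 \<le> 1\<^sup>2 * P + ((P + 1) / - y)\<^sup>2 * Q + 1 * ((P + 1) / - y) * y"
    using assms by (intro form) (auto simp: divide_simps)
  also have "\<dots> = -1"
    using assms True by (simp add: field_simps)
  finally show ?thesis by simp
next
  case False
  then have "0 < Q" using assms by simp
  have "0 \<le> (2 * Q)\<^sup>2 * P + (- y)\<^sup>2 * Q + (2 * Q) * (- y) * y"
    using assms by (intro form) auto
  also have "\<dots> = Q * (4 * P * Q - y\<^sup>2)"
    by (simp add: power2_eq_square algebra_simps)
  finally show ?thesis
    using \<open>0 < Q\<close> by (simp add: zero_le_mult_iff)
qed

text \<open>By \<open>gamma_plus_identity\<close> the imaginary mixed coefficient \<open>y\<close> has modulus at most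
  \<open>2 sqrt P sqrt Q\<close>, so its term is absorbed by the diagonal terms on completing a square; the real
  mixed term is nonnegative.\<close>

lemma gamma_plus_preserves:
  assumes "gamma_plus a b c d" and uv: "0 \<le> Re (u * cnj v)"
  shows "0 \<le> Re ((a * u + b * v) * cnj (c * u + d * v))"
proof -
  define P Q x y where "P = Re (a * cnj c)" and "Q = Re (b * cnj d)"
    and "x = Re (a * cnj d + b * cnj c)" and "y = Im (a * cnj d + cnj b * c)"
  have g: "cmod (a * d - b * c) \<le> x" "0 \<le> P" "0 \<le> Q"
    using assms by (auto simp: gamma_plus_def P_def Q_def x_def)
  have "(cmod (a * d - b * c))\<^sup>2 \<le> x\<^sup>2"
    using g by (intro power_mono) auto
  then have "y\<^sup>2 \<le> 4 * P * Q"
    using gamma_plus_identity[of a d b c] unfolding P_def Q_def x_def y_def by linarith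
  then have "sqrt (y\<^sup>2) \<le> sqrt (4 * P * Q)"
    by (rule real_sqrt_le_mono)
  then have y: "\<bar>y\<bar> \<le> 2 * sqrt P * sqrt Q"
    by (simp add: real_sqrt_mult)
  have "0 \<le> (cmod u * sqrt P - cmod v * sqrt Q)\<^sup>2" by simp
  also have "\<dots> = (cmod u)\<^sup>2 * P + (cmod v)\<^sup>2 * Q - cmod u * cmod v * (2 * sqrt P * sqrt Q)"
    using g by (simp add: power2_diff power_mult_distrib)
  also have "\<dots> \<le> (cmod u)\<^sup>2 * P + (cmod v)\<^sup>2 * Q - cmod u * cmod v * \<bar>y\<bar>"
    using y by (intro diff_left_mono mult_left_mono) auto
  also have "\<dots> \<le> (cmod u)\<^sup>2 * P + (cmod v)\<^sup>2 * Q - y * Im (u * cnj v)"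
  proof -
    have "y * Im (u * cnj v) \<le> \<bar>y\<bar> * \<bar>Im (u * cnj v)\<bar>"
      by (metis abs_ge_self abs_mult)
    also have "\<dots> \<le> \<bar>y\<bar> * cmod (u * cnj v)"
      by (intro mult_left_mono abs_Im_le_cmod) auto
    finally show ?thesis by (simp add: norm_mult mult_ac)
  qed
  also have "\<dots> \<le> (cmod u)\<^sup>2 * P + (cmod v)\<^sup>2 * Q + (x * Re (u * cnj v) - y * Im (u * cnj v))"
    using g(1) uv order_trans[OF norm_ge_zero g(1)] by simp
  finally show ?thesis
    unfolding Re_image_mult_cnj P_def Q_def x_def y_def .
qed

text \<open>Testing invariance on \<open>(s \<omega>, t)\<close> with \<open>s, t \<ge> 0\<close> and unimodular \<open>\<omega>\<close> of nonnegative real part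
  turns it into a discriminant bound for each \<open>\<omega>\<close>. The directions \<open>\<plusminus>\<i>\<close> give the determinant
  bound up to the sign of \<open>x = Re (a * cnj d + b * cnj c)\<close>. Invariance alone does not determine
  this sign: if \<open>x < 0\<close>, the worst direction \<open>\<omega>\<close> shows that the determinant vanishes, and it is in this
  rank one case that the row conditions exclude a negative \<open>x\<close>.\<close>

lemma gamma_plusI:
  assumes pres: "\<And>u v. 0 \<le> Re (u * cnj v) \<Longrightarrow>
      0 \<le> Re ((a * u + b * v) * cnj (c * u + d * v))"
    and row1: "0 \<le> Re (a * cnj b)" and row2: "0 \<le> Re (c * cnj d)"
  shows "gamma_plus a b c d"
proof -
  define P Q x y where "P = Re (a * cnj c)" and "Q = Re (b * cnj d)"
    and "x = Re (a * cnj d + b * cnj c)" and "y = Im (a * cnj d + cnj b * c)"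
  have P: "0 \<le> P" using pres[of 1 0] by (simp add: P_def)
  have Q: "0 \<le> Q" using pres[of 0 1] by (simp add: Q_def)
  have dir: "(x * Re \<omega> - y * Im \<omega>)\<^sup>2 \<le> 4 * P * Q"
    if \<omega>: "cmod \<omega> = 1" "0 \<le> Re \<omega>" "x * Re \<omega> - y * Im \<omega> < 0" for \<omega>
  proof (rule nonneg_quadratic_form_discriminant[OF P Q \<omega>(3)])
    fix s t :: real assume "0 \<le> s" "0 \<le> t"
    then have "0 \<le> Re ((of_real s * \<omega>) * cnj (of_real t))"
      using \<omega> by simp
    from pres[OF this] show "0 \<le> s\<^sup>2 * P + t\<^sup>2 * Q + s * t * (x * Re \<omega> - y * Im \<omega>)"
      unfolding Re_image_mult_cnj P_def[symmetric] Q_def[symmetric] x_def[symmetric] y_def[symmetric]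
      using \<omega> by (simp add: norm_mult algebra_simps)
  qed
  have id: "x\<^sup>2 + y\<^sup>2 = (cmod (a * d - b * c))\<^sup>2 + 4 * P * Q"
    using gamma_plus_identity[of a d b c] unfolding P_def Q_def x_def y_def .
  have y: "y\<^sup>2 \<le> 4 * P * Q"
  proof (cases "y = 0")
    case False
    show ?thesis using False dir[of \<i>] dir[of "- \<i>"] by (cases "0 < y") auto
  qed (use P Q in auto)
  have "0 \<le> x"
  proof (rule ccontr)
    assume "\<not> 0 \<le> x"
    then have x: "x < 0" by simp
    define r where "r = sqrt (x\<^sup>2 + y\<^sup>2)"
    have r: "0 < r" "r\<^sup>2 = x\<^sup>2 + y\<^sup>2"
      using x by (auto simp: r_def add_pos_nonneg)
    \<comment> \<open>the direction in which the mixed term of the quadratic form is smallest\<close>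
    define \<omega> where "\<omega> = Complex (- x / r) (y / r)"
    have "cmod \<omega> = sqrt ((x\<^sup>2 + y\<^sup>2) / r\<^sup>2)"
      unfolding \<omega>_def cmod_def by (simp add: power_divide add_divide_distrib)
    then have "cmod \<omega> = 1" using r(1) unfolding r(2)[symmetric] by simp
    moreover have "0 \<le> Re \<omega>" using x r(1) by (simp add: \<omega>_def divide_nonpos_pos)
    moreover have e: "x * Re \<omega> - y * Im \<omega> = - r"
    proof -
      have "x * Re \<omega> - y * Im \<omega> = - ((x\<^sup>2 + y\<^sup>2) / r)"
        by (simp add: \<omega>_def power2_eq_square add_divide_distrib)
      also have "\<dots> = - r" using r(1) unfolding r(2)[symmetric] by (simp add: power2_eq_square)
      finally show ?thesis .
    qed
    ultimately have "r\<^sup>2 \<le> 4 * P * Q" using dir[of \<omega>] r by simp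
    then have "(cmod (a * d - b * c))\<^sup>2 \<le> 0" using id r by linarith
    then have det: "a * d = b * c" by simp
    \<comment> \<open>With \<open>a d = b c\<close>, the numbers \<open>|a|\<^sup>2 x\<close> and \<open>|d|\<^sup>2 x\<close> factor into the given nonnegative ones.\<close>
    have Ra: "(cmod a)\<^sup>2 * x = 2 * Re (a * cnj b) * P"
    proof -
      have "of_real ((cmod a)\<^sup>2) * (a * cnj d + b * cnj c)
          = a\<^sup>2 * cnj (a * d) + a * cnj a * b * cnj c"
        unfolding complex_norm_square by (simp add: power2_eq_square algebra_simps)
      also have "\<dots> = (a * cnj c) * of_real (2 * Re (a * cnj b))"
        unfolding det by (simp add: complex_eq_iff power2_eq_square algebra_simps)
      finally have "of_real ((cmod a)\<^sup>2) * (a * cnj d + b * cnj c) = \<dots>" .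
      from arg_cong[OF this, of Re] show ?thesis
        unfolding x_def P_def by (simp add: mult.commute del: of_real_power)
    qed
    have Rd: "(cmod d)\<^sup>2 * x = 2 * Re (c * cnj d) * Q"
    proof -
      have "of_real ((cmod d)\<^sup>2) * (cnj a * d + cnj b * c)
          = d\<^sup>2 * cnj (a * d) + d * cnj d * cnj b * c"
        unfolding complex_norm_square by (simp add: power2_eq_square algebra_simps)
      also have "\<dots> = (cnj b * d) * of_real (2 * Re (c * cnj d))"
        unfolding det by (simp add: complex_eq_iff power2_eq_square algebra_simps)
      finally have "of_real ((cmod d)\<^sup>2) * (cnj a * d + cnj b * c) = \<dots>" .
      from arg_cong[OF this, of Re] show ?thesis
        unfolding x_def Q_def by (simp add: mult.commute del: of_real_power)
    qed
    have "0 \<le> (cmod a)\<^sup>2 * x" "0 \<le> (cmod d)\<^sup>2 * x"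
      unfolding Ra Rd using row1 row2 P Q by auto
    then have "a = 0" "d = 0"
      using x by (auto simp: zero_le_mult_iff)
    then have "b * c = 0" using det by simp
    then have "x = 0" unfolding x_def \<open>a = 0\<close> \<open>d = 0\<close> by auto
    then show False using x by simp
  qed
  moreover have "(cmod (a * d - b * c))\<^sup>2 \<le> x\<^sup>2" using id y by linarith
  ultimately have "cmod (a * d - b * c) \<le> x" by (rule power2_le_imp_le[rotated])
  then show ?thesis
    using P Q row1 row2 unfolding gamma_plus_def P_def Q_def x_def by simp
qed

lemma Re_complex_of_real_times: "Re (complex_of_real r * z) = r * Re z"
  by simp

lemma Re_sum_mult_cnj:
  "Re ((\<Sum>i\<in>F. complex_of_real (s i) * p i) * cnj (\<Sum>j\<in>G. complex_of_real (t j) * q j)) =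
     (\<Sum>i\<in>F. \<Sum>j\<in>G. s i * t j * Re (p i * cnj (q j)))"
proof -
  have "(\<Sum>i\<in>F. complex_of_real (s i) * p i) * cnj (\<Sum>j\<in>G. complex_of_real (t j) * q j) =
     (\<Sum>i\<in>F. \<Sum>j\<in>G. of_real (s i * t j) * (p i * cnj (q j)))"
    by (simp add: sum_product mult_ac)
  then show ?thesis by (simp only: Re_sum Re_complex_of_real_times)
qed

text \<open>Invariance of the cone is additive in the rows, but the condition that a single row
  \<open>(\<Sum>s i a i, \<Sum>s i b i)\<close> lies in the cone is not: its mixed terms \<open>Re (a i * cnj (b j))\<close> may be
  negative. They occur in pairs, and \<open>Re (a i * cnj (b j) + a j * cnj (b i))\<close> is the quantity that bounds
  the modulus of a determinant in the hypothesis.\<close>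

lemma gamma_plus_sum_rows:
  assumes g: "\<And>i j. i \<in> I \<Longrightarrow> j \<in> I \<Longrightarrow> gamma_plus (a i) (b i) (a j) (b j)"
    and F: "F \<subseteq> I" "\<And>i. i \<in> F \<Longrightarrow> 0 \<le> s i" and G: "G \<subseteq> I" "\<And>j. j \<in> G \<Longrightarrow> 0 \<le> t j"
  shows "gamma_plus (\<Sum>i\<in>F. complex_of_real (s i) * a i) (\<Sum>i\<in>F. complex_of_real (s i) * b i)
     (\<Sum>j\<in>G. complex_of_real (t j) * a j) (\<Sum>j\<in>G. complex_of_real (t j) * b j)"
proof -
  have row: "0 \<le> Re ((\<Sum>i\<in>H. complex_of_real (r i) * a i) * cnj (\<Sum>i\<in>H. complex_of_real (r i) * b i))"
    if H: "H \<subseteq> I" "\<And>i. i \<in> H \<Longrightarrow> 0 \<le> r i" for H and r :: "_ \<Rightarrow> real"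
  proof -
    define S where "S = (\<Sum>i\<in>H. \<Sum>j\<in>H. r i * r j * Re (a i * cnj (b j)))"
    have "S = (\<Sum>i\<in>H. \<Sum>j\<in>H. r i * r j * Re (b i * cnj (a j)))"
      unfolding S_def by (subst sum.swap) (simp add: algebra_simps)
    then have "2 * S = (\<Sum>i\<in>H. \<Sum>j\<in>H. r i * r j * Re (a i * cnj (b j) + b i * cnj (a j)))"
      unfolding S_def by (simp add: sum.distrib distrib_left)
    also have "\<dots> \<ge> 0"
    proof (intro sum_nonneg mult_nonneg_nonneg)
      fix i j assume "i \<in> H" "j \<in> H"
      then have "gamma_plus (a i) (b i) (a j) (b j)" using g H by auto
      then show "0 \<le> Re (a i * cnj (b j) + b i * cnj (a j))"
        unfolding gamma_plus_def using norm_ge_zero order_trans by blast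
    qed (use H in auto)
    finally show ?thesis unfolding Re_sum_mult_cnj S_def by simp
  qed
  show ?thesis
  proof (rule gamma_plusI)
    fix u v assume uv: "0 \<le> Re (u * cnj v)"
    have lin: "(\<Sum>i\<in>H. complex_of_real (r i) * a i) * u + (\<Sum>i\<in>H. complex_of_real (r i) * b i) * v
        = (\<Sum>i\<in>H. complex_of_real (r i) * (a i * u + b i * v))" for H and r :: "_ \<Rightarrow> real"
      by (simp add: sum_distrib_left sum_distrib_right distrib_left sum.distrib mult_ac)
    show "0 \<le> Re (((\<Sum>i\<in>F. complex_of_real (s i) * a i) * u + (\<Sum>i\<in>F. complex_of_real (s i) * b i) * v) *
        cnj ((\<Sum>j\<in>G. complex_of_real (t j) * a j) * u + (\<Sum>j\<in>G. complex_of_real (t j) * b j) * v))"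
      unfolding lin Re_sum_mult_cnj
    proof (intro sum_nonneg mult_nonneg_nonneg)
      fix i j assume "i \<in> F" "j \<in> G"
      then have "gamma_plus (a i) (b i) (a j) (b j)" by (intro g subsetD[OF F(1)] subsetD[OF G(1)])
      then show "0 \<le> Re ((a i * u + b i * v) * cnj (a j * u + b j * v))"
        using uv by (rule gamma_plus_preserves)
    qed (use F G in auto)
  qed (use row F G in auto)
qed

lemma gamma_plus_LIMSEQ:
  assumes "a \<longlonglongrightarrow> a'" "b \<longlonglongrightarrow> b'" "c \<longlonglongrightarrow> c'" "d \<longlonglongrightarrow> d'"
    and g: "\<And>n. gamma_plus (a n) (b n) (c n) (d n)"
  shows "gamma_plus a' b' c' d'"
  unfolding gamma_plus_def
proof (intro conjI)
  show "cmod (a' * d' - b' * c') \<le> Re (a' * cnj d' + b' * cnj c')"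
  proof (rule LIMSEQ_le)
    show "(\<lambda>n. cmod (a n * d n - b n * c n)) \<longlonglongrightarrow> cmod (a' * d' - b' * c')"
      by (intro tendsto_intros assms)
    show "(\<lambda>n. Re (a n * cnj (d n) + b n * cnj (c n))) \<longlonglongrightarrow> Re (a' * cnj d' + b' * cnj c')"
      by (intro tendsto_intros assms)
  qed (use g in \<open>auto simp: gamma_plus_def\<close>)
  have nonneg: "0 \<le> Re (z * cnj w)" if "p \<longlonglongrightarrow> z" "q \<longlonglongrightarrow> w" "\<And>n. 0 \<le> Re (p n * cnj (q n))"
    for p q z w
  proof (rule LIMSEQ_le_const)
    show "(\<lambda>n. Re (p n * cnj (q n))) \<longlonglongrightarrow> Re (z * cnj w)" by (intro tendsto_intros that)
  qed (use that in auto)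
  show "0 \<le> Re (a' * cnj b')" by (rule nonneg[OF assms(1,2)]) (use g in \<open>simp add: gamma_plus_def\<close>)
  show "0 \<le> Re (a' * cnj c')" by (rule nonneg[OF assms(1,3)]) (use g in \<open>simp add: gamma_plus_def\<close>)
  show "0 \<le> Re (b' * cnj d')" by (rule nonneg[OF assms(2,4)]) (use g in \<open>simp add: gamma_plus_def\<close>)
  show "0 \<le> Re (c' * cnj d')" by (rule nonneg[OF assms(3,4)]) (use g in \<open>simp add: gamma_plus_def\<close>)
qed


section \<open>The Hahn-Banach theorem and duality for closed cones\<close>

definition sublinear :: "('a::real_vector \<Rightarrow> real) \<Rightarrow> bool" where
  "sublinear p \<longleftrightarrow> (\<forall>x y. p (x + y) \<le> p x + p y) \<and> (\<forall>r\<ge>0. \<forall>x. p (r *\<^sub>R x) = r * p x)"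

lemma sublinearD:
  assumes "sublinear p"
  shows sublinear_add: "p (x + y) \<le> p x + p y"
    and sublinear_scale: "0 \<le> r \<Longrightarrow> p (r *\<^sub>R x) = r * p x"
    and sublinear_zero: "p 0 = 0"
    and sublinear_minus: "- p (- x) \<le> p x"
proof -
  show add: "p (x + y) \<le> p x + p y" for x y
    using assms by (simp add: sublinear_def)
  show scale: "0 \<le> r \<Longrightarrow> p (r *\<^sub>R x) = r * p x" for r x
    using assms by (simp add: sublinear_def)
  show zero: "p 0 = 0" using scale[of 0 0] by simp
  show "- p (- x) \<le> p x" using add[of x "- x"] zero by simp
qed

lemma sublinearI:
  assumes "\<And>x y. p (x + y) \<le> p x + p y" and "p 0 = 0"
    and le: "\<And>r x. 0 < r \<Longrightarrow> p (r *\<^sub>R x) \<le> r * p x"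
  shows "sublinear p"
proof -
  have "p (r *\<^sub>R x) = r * p x" if "0 \<le> r" for r x
  proof (cases "r = 0")
    case False
    then have r: "0 < r" using that by simp
    have "p ((1 / r) *\<^sub>R r *\<^sub>R x) \<le> (1 / r) * p (r *\<^sub>R x)"
      using r by (intro le) simp
    then have "r * p x \<le> p (r *\<^sub>R x)" using r by (simp add: field_simps)
    with le[OF r, of x] show ?thesis by simp
  qed (simp add: assms)
  then show ?thesis using assms(1) by (simp add: sublinear_def)
qed

text \<open>The witness \<open>q x = inf {p (x + t a) - t p a | t \<ge> 0}\<close> is the largest sublinear functional
  below \<open>p\<close> with this bound at \<open>- a\<close>. It serves twice: to make the linear functional of the
  Hahn-Banach theorem agree with \<open>p\<close> at \<open>a\<close>, and to show that minimal sublinear functionals are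
  odd.\<close>

lemma sublinear_lower_in_direction:
  assumes p: "sublinear p"
  obtains q where "sublinear q" "\<And>x. q x \<le> p x" "q (- a) \<le> - p a"
proof
  define f where "f x t = p (x + t *\<^sub>R a) - t * p a" for x t
  define q where "q x = (INF t\<in>{0..}. f x t)" for x
  have below: "- p (- x) \<le> f x t" if "0 \<le> t" for x t
    using sublinear_add[OF p, of "x + t *\<^sub>R a" "- x"] sublinear_scale[OF p that, of a]
    by (simp add: f_def)
  have q_le: "q x \<le> f x t" if "0 \<le> t" for x t
    unfolding q_def using that below
    by (intro cINF_lower bdd_belowI2[where m = "- p (- x)"]) auto
  have le_q: "c \<le> q x" if "\<And>t. 0 \<le> t \<Longrightarrow> c \<le> f x t" for c x
    unfolding q_def using that by (intro cINF_greatest) auto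
  show "q x \<le> p x" for x
    using q_le[of 0 x] by (simp add: f_def)
  show "q (- a) \<le> - p a"
    using q_le[of 1 "- a"] by (simp add: f_def sublinear_zero[OF p])
  show "sublinear q"
  proof (rule sublinearI)
    fix x y
    have "q (x + y) - f x s \<le> f y t" if "0 \<le> s" "0 \<le> t" for s t
    proof -
      have "q (x + y) \<le> f (x + y) (s + t)" using that by (intro q_le) simp
      also have "\<dots> \<le> f x s + f y t"
        using sublinear_add[OF p, of "x + s *\<^sub>R a" "y + t *\<^sub>R a"]
        by (simp add: f_def algebra_simps)
      finally show ?thesis by simp
    qed
    then have "q (x + y) - f x s \<le> q y" if "0 \<le> s" for s
      using that by (intro le_q)
    then have "q (x + y) - q y \<le> f x s" if "0 \<le> s" for s
      using that by (simp add: algebra_simps)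
    then have "q (x + y) - q y \<le> q x" by (intro le_q)
    then show "q (x + y) \<le> q x + q y" by simp
  next
    have "0 \<le> q 0"
      by (intro le_q) (simp add: f_def sublinear_scale[OF p])
    moreover have "q 0 \<le> 0"
      using q_le[of 0 0] by (simp add: f_def sublinear_zero[OF p])
    ultimately show "q 0 = 0" by simp
  next
    fix r :: real and x assume r: "0 < r"
    have "q (r *\<^sub>R x) / r \<le> f x t" if "0 \<le> t" for t
    proof -
      have "q (r *\<^sub>R x) \<le> f (r *\<^sub>R x) (r * t)" using r that by (intro q_le) simp
      also have "\<dots> = r * f x t"
        using sublinear_scale[OF p, of r "x + t *\<^sub>R a"] r by (simp add: f_def algebra_simps)
      finally show ?thesis using r by (simp add: field_simps)
    qed
    then have "q (r *\<^sub>R x) / r \<le> q x" by (intro le_q)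
    then show "q (r *\<^sub>R x) \<le> r * q x" using r by (simp add: field_simps)
  qed
qed

lemma minimal_sublinear_exists:
  assumes p: "sublinear p"
  obtains m where "sublinear m" "\<And>x. m x \<le> p x"
    "\<And>q. sublinear q \<Longrightarrow> (\<And>x. q x \<le> m x) \<Longrightarrow> q = m"
proof -
  define A where "A = {q. sublinear q \<and> q \<le> p}"
  have "\<exists>m\<in>A. \<forall>q\<in>A. q \<le> m \<longrightarrow> q = m"
  proof (rule predicate_Zorn)
    show "partial_order_on A (relation_of (\<lambda>m q. q \<le> m) A)"
      unfolding partial_order_on_def preorder_on_def refl_on_def trans_def antisym_def relation_of_def
      by auto
  next
    \<comment> \<open>A chain has its pointwise infimum as lower bound, finite because \<open>q x \<ge> - p (- x)\<close>.\<close>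
    fix C assume C: "C \<in> Chains (relation_of (\<lambda>m q. q \<le> m) A)"
    have CA: "C \<subseteq> A" and tot: "\<And>q1 q2. q1 \<in> C \<Longrightarrow> q2 \<in> C \<Longrightarrow> q1 \<le> q2 \<or> q2 \<le> q1"
      using C unfolding Chains_def relation_of_def by auto
    show "\<exists>u\<in>A. \<forall>q\<in>C. u \<le> q"
    proof (cases "C = {}")
      case True
      then show ?thesis using p by (auto simp: A_def)
    next
      case False
      define u where "u x = (INF q\<in>C. q x)" for x
      have sub: "sublinear q" and le_p: "q x \<le> p x" if "q \<in> C" for q x
        using CA that by (auto simp: A_def le_fun_def)
      have below: "- p (- x) \<le> q x" if "q \<in> C" for q x
        using sublinear_minus[OF sub[OF that], of x] le_p[OF that, of "- x"] by linarith
      have u_le: "u x \<le> q x" if "q \<in> C" for q x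
        unfolding u_def using that below
        by (intro cINF_lower bdd_belowI2[where m = "- p (- x)"]) auto
      have le_u: "c \<le> u x" if "\<And>q. q \<in> C \<Longrightarrow> c \<le> q x" for c x
        unfolding u_def using that False by (intro cINF_greatest) auto
      obtain q0 where q0: "q0 \<in> C" using False by auto
      have "sublinear u"
      proof (rule sublinearI)
        fix x y
        have "u (x + y) - q1 x \<le> q2 y" if q12: "q1 \<in> C" "q2 \<in> C" for q1 q2
        proof -
          obtain q where q: "q \<in> C" "q \<le> q1" "q \<le> q2"
            using tot[OF q12] q12 by (metis order_refl)
          have "u (x + y) \<le> q (x + y)" using q by (intro u_le)
          also have "\<dots> \<le> q x + q y" by (rule sublinear_add[OF sub[OF q(1)]])
          also have "\<dots> \<le> q1 x + q2 y" using q by (intro add_mono) (auto simp: le_fun_def)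
          finally show ?thesis by simp
        qed
        then have "u (x + y) - q1 x \<le> u y" if "q1 \<in> C" for q1 using that by (intro le_u)
        then have "u (x + y) - u y \<le> q1 x" if "q1 \<in> C" for q1
          using that by (simp add: algebra_simps)
        then have "u (x + y) - u y \<le> u x" by (intro le_u)
        then show "u (x + y) \<le> u x + u y" by simp
      next
        have "0 \<le> u 0" by (intro le_u) (simp add: sublinear_zero[OF sub])
        then show "u 0 = 0"
          using u_le[OF q0, of 0] by (simp add: sublinear_zero[OF sub[OF q0]])
      next
        fix r :: real and x assume r: "0 < r"
        have "u (r *\<^sub>R x) / r \<le> q x" if "q \<in> C" for q
          using u_le[OF that, of "r *\<^sub>R x"] sublinear_scale[OF sub[OF that], of r x] r
          by (simp add: field_simps)
        then have "u (r *\<^sub>R x) / r \<le> u x" by (intro le_u)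
        then show "u (r *\<^sub>R x) \<le> r * u x" using r by (simp add: field_simps)
      qed
      moreover have "u \<le> p"
        using u_le[OF q0] le_p[OF q0] order_trans by (fastforce simp: le_fun_def)
      ultimately show ?thesis using u_le by (auto simp: A_def le_fun_def intro!: bexI[of _ u])
    qed
  qed
  then obtain m where m: "m \<in> A" "\<And>q. q \<in> A \<Longrightarrow> q \<le> m \<Longrightarrow> q = m" by blast
  show thesis
  proof (rule that)
    show "sublinear m" "\<And>x. m x \<le> p x" using m(1) by (auto simp: A_def le_fun_def)
    show "q = m" if "sublinear q" "\<And>x. q x \<le> m x" for q
    proof (rule m(2))
      show "q \<le> m" using that by (simp add: le_fun_def)
      then show "q \<in> A" using that m(1) by (auto simp: A_def)
    qed
  qed
qed

text \<open>A minimal sublinear functional is linear: lowering it in the direction \<open>x\<close> cannot change it,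
  which forces \<open>m (- x) \<le> - m x\<close>, and an odd sublinear functional is linear.\<close>

theorem hahn_banach_sublinear:
  fixes p :: "'a::real_vector \<Rightarrow> real"
  assumes p: "sublinear p"
  obtains l where "linear l" "\<And>x. l x \<le> p x" "l a = p a"
proof -
  obtain q where q: "sublinear q" "\<And>x. q x \<le> p x" "q (- a) \<le> - p a"
    using sublinear_lower_in_direction[OF p] by blast
  obtain m where m: "sublinear m" "\<And>x. m x \<le> q x"
    and min: "\<And>q. sublinear q \<Longrightarrow> (\<And>x. q x \<le> m x) \<Longrightarrow> q = m"
    using minimal_sublinear_exists[OF q(1)] by blast
  have neg: "m (- x) = - m x" for x
  proof (rule antisym)
    obtain q' where "sublinear q'" "\<And>y. q' y \<le> m y" "q' (- x) \<le> - m x"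
      using sublinear_lower_in_direction[OF m(1)] by blast
    then show "m (- x) \<le> - m x" using min[of q'] by simp
    show "- m x \<le> m (- x)" using sublinear_minus[OF m(1), of "- x"] by simp
  qed
  have "linear m"
  proof (rule linearI)
    fix x y
    have "m x \<le> m (x + y) + m (- y)" using sublinear_add[OF m(1), of "x + y" "- y"] by simp
    then show "m (x + y) = m x + m y" using sublinear_add[OF m(1), of x y] neg[of y] by simp
  next
    fix r x
    show "m (r *\<^sub>R x) = r *\<^sub>R m x"
    proof (cases "0 \<le> r")
      case False
      then have "m ((- r) *\<^sub>R (- x)) = (- r) * m (- x)"
        by (intro sublinear_scale[OF m(1)]) simp
      then show ?thesis by (simp add: neg)
    qed (simp add: sublinear_scale[OF m(1)])
  qed
  moreover have le: "m x \<le> p x" for x using m(2)[of x] q(2)[of x] by linarith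
  moreover have "m a = p a"
    using neg[of a] m(2)[of "- a"] q(3) le[of a] by linarith
  ultimately show thesis by (rule that)
qed

lemma real_coneD:
  assumes "real_cone K"
  shows real_cone_closed: "closed K"
    and real_cone_zero: "0 \<in> K"
    and real_cone_add: "x \<in> K \<Longrightarrow> y \<in> K \<Longrightarrow> x + y \<in> K"
    and real_cone_scale: "0 \<le> t \<Longrightarrow> x \<in> K \<Longrightarrow> t *\<^sub>R x \<in> K"
  using assms unfolding real_cone_def by (blast+)

lemma sublinear_infdist_cone:
  assumes K: "real_cone K"
  shows "sublinear (\<lambda>x. infdist x K)"
proof (rule sublinearI)
  have ne: "K \<noteq> {}" using real_cone_zero[OF K] by auto
  have le_infdist: "c \<le> infdist x K" if "\<And>k. k \<in> K \<Longrightarrow> c \<le> dist x k" for c x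
    unfolding infdist_notempty[OF ne] using ne that by (intro cINF_greatest)
  fix x y
  have "infdist (x + y) K - dist x h \<le> dist y k" if "h \<in> K" "k \<in> K" for h k
  proof -
    have "infdist (x + y) K \<le> dist (x + y) (h + k)"
      using that by (intro infdist_le real_cone_add[OF K])
    also have "\<dots> \<le> dist x h + dist y k" by (rule dist_triangle_add)
    finally show ?thesis by simp
  qed
  then have "infdist (x + y) K - dist x h \<le> infdist y K" if "h \<in> K" for h
    using that by (intro le_infdist)
  then have "infdist (x + y) K - infdist y K \<le> dist x h" if "h \<in> K" for h
    using that by (simp add: algebra_simps)
  then have "infdist (x + y) K - infdist y K \<le> infdist x K" by (intro le_infdist)
  then show "infdist (x + y) K \<le> infdist x K + infdist y K" by simp
next
  show "infdist 0 K = 0" using real_cone_zero[OF K] by simp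
next
  have ne: "K \<noteq> {}" using real_cone_zero[OF K] by auto
  fix r :: real and x assume r: "0 < r"
  have "infdist (r *\<^sub>R x) K / r \<le> dist x k" if "k \<in> K" for k
  proof -
    have "infdist (r *\<^sub>R x) K \<le> dist (r *\<^sub>R x) (r *\<^sub>R k)"
      using that r by (intro infdist_le real_cone_scale[OF K]) auto
    also have "\<dots> = r * dist x k"
      using r by (simp add: dist_norm flip: scaleR_diff_right)
    finally show ?thesis using r by (simp add: field_simps)
  qed
  then have "infdist (r *\<^sub>R x) K / r \<le> infdist x K"
    unfolding infdist_notempty[OF ne, of x] using ne by (intro cINF_greatest)
  then show "infdist (r *\<^sub>R x) K \<le> r * infdist x K" using r by (simp add: field_simps)
qed

text \<open>The distance to the cone is sublinear, vanishes on \<open>K\<close> and is bounded by the norm. If \<open>l\<close> is a linear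
  functional below it with equality at \<open>x\<close>, then \<open>- l\<close> is in the dual cone, so the
  distance of \<open>x\<close> to \<open>K\<close> is zero.\<close>

lemma dual_cone_separates:
  fixes K :: "'r::banach set"
  assumes K: "real_cone K" and x: "\<And>l. l \<in> dual_cone K \<Longrightarrow> 0 \<le> blinfun_apply l x"
  shows "x \<in> K"
proof -
  obtain l where l: "linear l" "\<And>y. l y \<le> infdist y K" "l x = infdist x K"
    using hahn_banach_sublinear[OF sublinear_infdist_cone[OF K]] by blast
  have "l y \<le> norm y" for y
    using l(2)[of y] infdist_le[OF real_cone_zero[OF K], of y] by simp
  then have "\<bar>l y\<bar> \<le> norm y" for y
    using linear_neg[OF l(1), of y] by (metis abs_le_iff norm_minus_cancel)
  then have "bounded_linear (\<lambda>y. - l y)"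
    using l(1) by (intro bounded_linear_minus bounded_linear_intro[where K = 1])
      (auto simp: linear_add linear_scale)
  then have app: "blinfun_apply (Blinfun (\<lambda>y. - l y)) y = - l y" for y
    by (simp add: bounded_linear_Blinfun_apply)
  have "Blinfun (\<lambda>y. - l y) \<in> dual_cone K"
    unfolding dual_cone_def
  proof (intro CollectI ballI)
    fix y assume "y \<in> K"
    then show "0 \<le> blinfun_apply (Blinfun (\<lambda>y. - l y)) y" using l(2)[of y] by (simp add: app)
  qed
  then have "infdist x K \<le> 0" using x app l(3) by fastforce
  then have "infdist x K = 0" using infdist_nonneg[of x K] by simp
  then show ?thesis
    using in_closed_iff_infdist_zero[OF real_cone_closed[OF K]] real_cone_zero[OF K] by auto
qed


section \<open>Rotating a set of complex numbers into the first quadrant\<close>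

text \<open>After a rotation of one nonzero element to the positive axis all arguments lie in \<open>[-\<pi>/2, \<pi>/2]\<close>, where differences
  of arguments are honest angles. They are at most \<open>\<pi>/2\<close>, so rotating by the infimum of the
  arguments does it.\<close>

lemma rotation_into_first_quadrant:
  assumes S: "\<And>z w. z \<in> S \<Longrightarrow> w \<in> S \<Longrightarrow> 0 \<le> Re (z * cnj w)"
  obtains \<theta> where "\<And>z. z \<in> S \<Longrightarrow> 0 \<le> Re (cis \<theta> * z)" "\<And>z. z \<in> S \<Longrightarrow> 0 \<le> Im (cis \<theta> * z)"
proof (cases "S \<subseteq> {0}")
  case True
  then show thesis by (intro that[of 0]) auto
next
  case False
  then obtain w where w: "w \<in> S" "w \<noteq> 0" by auto
  define arg where "arg z = Arg (z * cnj w)" for z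
  define T where "T = S - {0}"
  have nz: "z * cnj w \<noteq> 0" if "z \<in> T" for z using that w by (auto simp: T_def)
  have polar: "z * cnj w = rcis (cmod (z * cnj w)) (arg z)" for z
    unfolding arg_def by (simp add: rcis_cmod_Arg)
  have arg: "\<bar>arg z\<bar> \<le> pi / 2" if "z \<in> T" for z
    unfolding arg_def Arg_Re_nonneg using that w S by (auto simp: T_def)
  have diff: "\<bar>arg z - arg z'\<bar> \<le> pi / 2" if zz: "z \<in> T" "z' \<in> T" for z z'
  proof (rule ccontr)
    assume "\<not> ?thesis"
    then have "pi / 2 < \<bar>arg z - arg z'\<bar>" by simp
    moreover have "\<bar>arg z - arg z'\<bar> \<le> pi" using arg[OF zz(1)] arg[OF zz(2)] by linarith
    ultimately have "cos \<bar>arg z - arg z'\<bar> < cos (pi / 2)"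
      by (intro cos_monotone_0_pi) auto
    then have neg: "cos (arg z - arg z') < 0" by simp
    have "(z * cnj w) * cnj (z' * cnj w) =
        rcis (cmod (z * cnj w) * cmod (z' * cnj w)) (arg z - arg z')"
      by (subst polar[of z], subst polar[of z']) (simp add: rcis_def cis_cnj cis_mult)
    then have "Re ((z * cnj w) * cnj (z' * cnj w)) =
        cmod (z * cnj w) * cmod (z' * cnj w) * cos (arg z - arg z')"
      by simp
    also have "\<dots> < 0" using nz zz neg by (intro mult_pos_neg) auto
    also have "(z * cnj w) * cnj (z' * cnj w) = of_real ((cmod w)\<^sup>2) * (z * cnj z')"
      unfolding complex_norm_square by (simp add: mult_ac)
    finally have "(cmod w)\<^sup>2 * Re (z * cnj z') < 0"
      by (simp add: algebra_simps del: of_real_power)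
    then show False using S[of z z'] zz by (auto simp: T_def mult_less_0_iff)
  qed
  define \<alpha> where "\<alpha> = (INF z\<in>T. arg z)"
  have wT: "w \<in> T" using w by (simp add: T_def)
  have bdd: "bdd_below (arg ` T)"
  proof (rule bdd_belowI2)
    show "- (pi / 2) \<le> arg z" if "z \<in> T" for z using arg[OF that] by linarith
  qed
  have lower: "\<alpha> \<le> arg z" if "z \<in> T" for z
    unfolding \<alpha>_def using bdd that by (intro cINF_lower)
  have upper: "arg z - pi / 2 \<le> \<alpha>" if "z \<in> T" for z
    unfolding \<alpha>_def
  proof (rule cINF_greatest)
    show "arg z - pi / 2 \<le> arg z'" if "z' \<in> T" for z'
      using diff[OF \<open>z \<in> T\<close> that] by linarith
  qed (use wT in auto)
  define \<theta> where "\<theta> = Arg (cnj w) - \<alpha>"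
  have quad: "0 \<le> Re (cis \<theta> * z) \<and> 0 \<le> Im (cis \<theta> * z)" if "z \<in> S" for z
  proof (cases "z = 0")
    case False
    then have zT: "z \<in> T" using that by (simp add: T_def)
    have "cis \<theta> = cis (- \<alpha>) * cis (Arg (cnj w))"
      by (simp add: \<theta>_def cis_mult)
    then have "of_real (cmod w) * (cis \<theta> * z) = cis (- \<alpha>) * (z * (of_real (cmod w) * cis (Arg (cnj w))))"
      by (simp only: mult_ac)
    also have "of_real (cmod w) * cis (Arg (cnj w)) = cnj w"
      using rcis_cmod_Arg[of "cnj w"] by (simp add: rcis_def)
    also have "cis (- \<alpha>) * (z * cnj w) = rcis (cmod (z * cnj w)) (arg z - \<alpha>)"
      by (subst polar) (simp add: rcis_def cis_mult)
    finally have e: "of_real (cmod w) * (cis \<theta> * z) = rcis (cmod (z * cnj w)) (arg z - \<alpha>)" .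
    have "0 \<le> arg z - \<alpha>" "arg z - \<alpha> \<le> pi / 2" using lower[OF zT] upper[OF zT] by auto
    then have "0 \<le> cos (arg z - \<alpha>)" "0 \<le> sin (arg z - \<alpha>)"
      by (auto intro!: cos_ge_zero sin_ge_zero)
    then have "0 \<le> cmod w * Re (cis \<theta> * z)" "0 \<le> cmod w * Im (cis \<theta> * z)"
      using arg_cong[OF e, of Re] arg_cong[OF e, of Im] by auto
    then show ?thesis using w(2) by (auto simp: zero_le_mult_iff)
  qed simp
  show thesis by (rule that[of \<theta>]) (use quad in auto)
qed

section \<open>The bounded inverse theorem\<close>

text \<open>By Baire's theorem the closure of the image of some ball contains a ball around some \<open>y0\<close>. Symmetry
  and convexity of the image move the centre to the origin: \<open>y\<close> is half the difference of
  \<open>y0 + y\<close> and \<open>y0 - y\<close>.\<close>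

lemma bounded_linear_surj_almost_open:
  fixes T :: "'a::real_normed_vector \<Rightarrow> 'b::banach"
  assumes T: "bounded_linear T" and "surj T"
  shows "\<exists>C\<ge>0. \<forall>y. \<forall>\<epsilon>>0. \<exists>x. norm x \<le> C * norm y \<and> norm (T x - y) < \<epsilon>"
proof -
  interpret bounded_linear T by fact
  define B where "B n = closure (T ` cball 0 (real n))" for n
  have "(\<Union>n. B n) = UNIV"
  proof (intro set_eqI iffI UNIV_I)
    fix y obtain x where "y = T x" using \<open>surj T\<close> by auto
    moreover have "norm x \<le> real (nat \<lceil>norm x\<rceil>)" by linarith
    ultimately have "y \<in> B (nat \<lceil>norm x\<rceil>)"
      unfolding B_def by (intro subsetD[OF closure_subset]) auto
    then show "y \<in> (\<Union>n. B n)" by blast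
  qed
  moreover have "interior (\<Union>(range B)) = {}" if "\<And>n. interior (B n) = {}"
  proof -
    have "Met_TC.mtopology interior_of \<Union>(range B) = {}"
      by (rule Met_TC.metric_Baire_category_alt) (use that in \<open>auto simp: B_def complete_UNIV\<close>)
    then show ?thesis by simp
  qed
  ultimately obtain n where "interior (B n) \<noteq> {}" by fastforce
  then obtain y0 r where r: "0 < r" "cball y0 r \<subseteq> B n"
    by (metis all_not_in_conv mem_interior_cball)
  have near: "\<exists>x. norm x \<le> real n \<and> norm (T x - y) < \<epsilon>" if y: "norm y \<le> r" and "0 < \<epsilon>" for y \<epsilon>
  proof -
    have "y0 + y \<in> B n" "y0 - y \<in> B n" using y r(2) by (auto simp: subset_iff dist_norm)
    then obtain x1 x2 where x: "norm x1 \<le> real n" "norm (T x1 - (y0 + y)) < \<epsilon>"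
        "norm x2 \<le> real n" "norm (T x2 - (y0 - y)) < \<epsilon>"
      unfolding B_def closure_approachable using \<open>0 < \<epsilon>\<close> by (force simp: dist_norm)
    have "norm ((1/2) *\<^sub>R (x1 - x2)) \<le> real n"
      using norm_triangle_ineq4[of x1 x2] x by simp
    moreover have "T ((1/2) *\<^sub>R (x1 - x2)) - y = (1/2) *\<^sub>R ((T x1 - (y0 + y)) - (T x2 - (y0 - y)))"
      by (simp add: scaleR diff algebra_simps flip: scaleR_add_left)
    then have "norm (T ((1/2) *\<^sub>R (x1 - x2)) - y) < \<epsilon>"
      using norm_triangle_ineq4[of "T x1 - (y0 + y)" "T x2 - (y0 - y)"] x by simp
    ultimately show ?thesis by blast
  qed
  show ?thesis
  proof (intro exI[of _ "real n / r"] conjI allI impI)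
    show "0 \<le> real n / r" using r by simp
    fix y and \<epsilon> :: real assume \<epsilon>: "0 < \<epsilon>"
    show "\<exists>x. norm x \<le> real n / r * norm y \<and> norm (T x - y) < \<epsilon>"
    proof (cases "y = 0")
      case True
      then show ?thesis using \<epsilon> by (intro exI[of _ 0]) (simp add: zero)
    next
      case False
      define s where "s = norm y / r"
      have s: "0 < s" using False r by (simp add: s_def)
      have "norm ((1 / s) *\<^sub>R y) \<le> r" using False r by (simp add: s_def)
      then obtain x where x: "norm x \<le> real n" "norm (T x - (1 / s) *\<^sub>R y) < \<epsilon> / s"
        using near \<epsilon> s by (metis divide_pos_pos)
      have "T (s *\<^sub>R x) - y = s *\<^sub>R (T x - (1 / s) *\<^sub>R y)"
        using s by (simp add: scaleR algebra_simps)
      then have "norm (T (s *\<^sub>R x) - y) = s * norm (T x - (1 / s) *\<^sub>R y)"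
        using s by (simp only: norm_scaleR abs_of_pos)
      then have "norm (T (s *\<^sub>R x) - y) < \<epsilon>"
        using x(2) s by (simp add: field_simps)
      moreover have "norm (s *\<^sub>R x) \<le> real n / r * norm y"
        using x(1) s r mult_left_mono[OF x(1), of s] by (simp add: s_def mult_ac)
      ultimately show ?thesis by blast
    qed
  qed
qed

text \<open>Solve \<open>T x = y\<close> up to an error of half the norm of \<open>y\<close> by \<open>g y\<close>, then treat the error in the same way.
  The corrections decrease geometrically, so they sum to a solution whose norm is at most
  \<open>2 C\<close> times that of \<open>y\<close>.\<close>

theorem bounded_inverse:
  fixes T :: "'a::banach \<Rightarrow> 'b::banach"
  assumes T: "bounded_linear T" and "bij T"
  obtains C where "\<And>x. norm x \<le> C * norm (T x)"
proof -
  interpret bounded_linear T by fact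
  obtain C where C: "0 \<le> C"
    "\<forall>y. \<forall>\<epsilon>>0. \<exists>x. norm x \<le> C * norm y \<and> norm (T x - y) < \<epsilon>"
    using bounded_linear_surj_almost_open[OF T bij_is_surj[OF \<open>bij T\<close>]] by blast
  have "\<exists>x. norm x \<le> C * norm y \<and> norm (y - T x) \<le> norm y / 2" for y
  proof (cases "y = 0")
    case False
    then obtain x where "norm x \<le> C * norm y" "norm (T x - y) < norm y / 2"
      using C(2)[rule_format, of "norm y / 2" y] by auto
    then show ?thesis by (intro exI[of _ x]) (simp add: norm_minus_commute)
  next
    case True
    then show ?thesis by (intro exI[of _ 0]) (simp add: zero)
  qed
  then obtain g where g: "\<And>y. norm (g y) \<le> C * norm y" "\<And>y. norm (y - T (g y)) \<le> norm y / 2"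
    by metis
  have "norm x \<le> 2 * C * norm (T x)" for x
  proof -
    \<comment> \<open>the successive errors\<close>
    define y where "y k = ((\<lambda>y. y - T (g y)) ^^ k) (T x)" for k
    have y0: "y 0 = T x" and ySuc: "y (Suc k) = y k - T (g (y k))" for k
      by (simp_all add: y_def)
    have y_le: "norm (y k) \<le> norm (T x) * (1/2) ^ k" for k
    proof (induction k)
      case (Suc k)
      have "norm (y (Suc k)) \<le> norm (y k) / 2" unfolding ySuc by (rule g)
      with Suc show ?case by simp
    qed (simp add: y0)
    have gy_le: "norm (g (y k)) \<le> C * norm (T x) * (1/2) ^ k" for k
      using g(1)[of "y k"] mult_left_mono[OF y_le[of k] C(1)] by (simp add: mult_ac)
    have geo: "(\<lambda>k. C * norm (T x) * (1/2) ^ k) sums (C * norm (T x) * 2)"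
      using sums_mult[OF geometric_sums[of "1/2::real"], of "C * norm (T x)"] by simp
    have sn: "summable (\<lambda>k. norm (g (y k)))"
      using gy_le by (intro summable_comparison_test'[OF sums_summable[OF geo], of 0]) auto
    then have sm: "summable (\<lambda>k. g (y k))" by (rule summable_norm_cancel)
    have "norm (\<Sum>k. g (y k)) \<le> (\<Sum>k. norm (g (y k)))" by (rule summable_norm[OF sn])
    also have "\<dots> \<le> C * norm (T x) * 2"
      unfolding sums_unique[OF geo] by (intro suminf_le gy_le sn sums_summable[OF geo])
    finally have le: "norm (\<Sum>k. g (y k)) \<le> C * norm (T x) * 2" .
    have "(\<lambda>k. norm (T x) * (1/2) ^ k) \<longlonglongrightarrow> norm (T x) * 0"
      by (intro tendsto_intros LIMSEQ_power_zero) simp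
    then have geo0: "(\<lambda>k. norm (T x) * (1/2) ^ k) \<longlonglongrightarrow> 0" by simp
    have "y \<longlonglongrightarrow> 0"
      by (rule Lim_null_comparison[OF always_eventually geo0]) (use y_le in blast)
    then have "(\<lambda>k. y k - y (Suc k)) sums (y 0 - 0)" by (rule telescope_sums')
    then have "(\<lambda>k. T (g (y k))) sums T x" by (simp add: ySuc y0)
    moreover have "(\<lambda>k. T (g (y k))) sums T (\<Sum>k. g (y k))"
      by (rule sums[OF summable_sums[OF sm]])
    ultimately have "T (\<Sum>k. g (y k)) = T x" by (rule sums_unique2[symmetric])
    then have "(\<Sum>k. g (y k)) = x" using \<open>bij T\<close> by (auto dest: bij_is_inj injD)
    with le show ?thesis by (simp add: mult_ac)
  qed
  then show thesis by (rule that)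
qed


section \<open>Complexified cones\<close>

lemma scaleC_zero_right: "c *\<^sub>C (0::'a::complex_normed_vector) = 0"
  using scaleC_add_right[of c 0 "0::'a"] by simp

lemma scaleC_diff_left: "(c - d) *\<^sub>C x = c *\<^sub>C x - d *\<^sub>C (x::'a::complex_normed_vector)"
  using scaleC_add_left[of "c - d" d x] by simp

lemma scaleC_minus_left: "(- c) *\<^sub>C x = - (c *\<^sub>C (x::'a::complex_normed_vector))"
  using scaleC_diff_left[of 0 c x] scaleC_diff_left[of 0 0 x] by simp

lemma complex_operator_scaleC:
  "A \<in> complex_operators \<Longrightarrow> blinfun_apply A (c *\<^sub>C x) = c *\<^sub>C blinfun_apply A x"
  by (simp add: complex_operators_def)

lemma complex_dual_scaleC:
  "\<mu> \<in> complex_dual \<Longrightarrow> blinfun_apply \<mu> (c *\<^sub>C x) = c * blinfun_apply \<mu> x"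
  by (simp add: complex_operators_def scaleC_complex_def)

context
  fixes J :: "'r::banach \<Rightarrow> 'x::complex_banach"
  assumes J: "complexification J"
begin

lemma bounded_linear_embedding: "bounded_linear J"
  using J unfolding complexification_def
  by (intro bounded_linear_intro[where K = 1]) (auto simp: linear_add linear_scale)

lemma complexification_cases:
  obtains a b where "x = J a + \<i> *\<^sub>C J b"
proof -
  have "surj (real_imag_sum J)" using J by (simp add: complexification_def bij_def)
  then obtain p where "x = real_imag_sum J p" by (rule surjE)
  then show thesis by (intro that[of "fst p" "snd p"]) (simp add: real_imag_sum_def case_prod_beta)
qed

lemma complex_extension_embedding: "complex_extension J l (J a) = of_real (blinfun_apply l a)"
proof -
  have "J a = J a + \<i> *\<^sub>C J 0"
    by (simp add: linear_simps(3)[OF bounded_linear_embedding] scaleC_zero_right)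
  then show ?thesis using complex_extension_eq[OF J, of l a 0] by (simp add: blinfun.zero_right)
qed

lemma complex_extension_add:
  "complex_extension J l (x + y) = complex_extension J l x + complex_extension J l y"
proof -
  obtain a b where x: "x = J a + \<i> *\<^sub>C J b" by (rule complexification_cases)
  obtain a' b' where y: "y = J a' + \<i> *\<^sub>C J b'" by (rule complexification_cases)
  have "x + y = J (a + a') + \<i> *\<^sub>C J (b + b')"
    by (simp add: x y linear_simps(1)[OF bounded_linear_embedding] scaleC_add_right)
  then show ?thesis
    by (simp add: x y complex_extension_eq[OF J] blinfun.add_right algebra_simps)
qed

lemma complex_extension_scaleC:
  "complex_extension J l (c *\<^sub>C x) = c * complex_extension J l x"
proof -
  interpret bounded_linear J by (rule bounded_linear_embedding)
  obtain a b where x: "x = J a + \<i> *\<^sub>C J b" by (rule complexification_cases)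
  obtain p q where c: "c = of_real p + \<i> * of_real q" by (metis complex_eq)
  have "c *\<^sub>C x = J (p *\<^sub>R a + (- q) *\<^sub>R b) + \<i> *\<^sub>C J (q *\<^sub>R a + p *\<^sub>R b)"
    by (simp only: x c add scaleR scaleR_scaleC scaleC_add_right scaleC_add_left scaleC_scaleC)
      (simp add: scaleC_add_left scaleC_diff_left scaleC_minus_left algebra_simps)
  then show ?thesis
    by (simp only: complex_extension_eq[OF J] x)
      (simp add: c blinfun.add_right blinfun.scaleR_right blinfun.diff_right algebra_simps)
qed

lemma complex_extension_scaleR:
  "complex_extension J l (r *\<^sub>R x) = r *\<^sub>R complex_extension J l x"
  by (simp add: scaleR_scaleC complex_extension_scaleC scaleC_complex_def)

lemma complex_extension_sum_functionals:
  "complex_extension J (\<Sum>l\<in>F. t l *\<^sub>R l) x = (\<Sum>l\<in>F. of_real (t l) * complex_extension J l x)"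
proof -
  obtain a b where x: "x = J a + \<i> *\<^sub>C J b" by (rule complexification_cases)
  have "blinfun_apply (\<Sum>l\<in>F. t l *\<^sub>R l) a = (\<Sum>l\<in>F. t l * blinfun_apply l a)" for a
    by (simp add: blinfun.sum_left blinfun.scaleR_left)
  then show ?thesis
    by (simp add: x complex_extension_eq[OF J] sum_distrib_left sum.distrib algebra_simps)
qed

lemma bounded_linear_real_imag_sum: "bounded_linear (real_imag_sum J)"
proof -
  interpret bounded_linear J by (rule bounded_linear_embedding)
  show ?thesis
  proof (rule bounded_linear_intro[where K = 2])
    fix p q :: "'r \<times> 'r" and r :: real
    show "real_imag_sum J (p + q) = real_imag_sum J p + real_imag_sum J q"
      by (simp add: real_imag_sum_def case_prod_beta add scaleC_add_right)
    show "real_imag_sum J (r *\<^sub>R p) = r *\<^sub>R real_imag_sum J p"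
      by (simp add: real_imag_sum_def case_prod_beta scaleR scaleR_scaleC scaleC_add_right
          scaleC_scaleC mult.commute)
    have "norm (real_imag_sum J p) \<le> norm (J (fst p)) + norm (\<i> *\<^sub>C J (snd p))"
      by (simp add: real_imag_sum_def case_prod_beta norm_triangle_ineq)
    also have "\<dots> = norm (fst p) + norm (snd p)"
      using J by (simp add: norm_scaleC complexification_def)
    also have "\<dots> \<le> norm p * 2"
      using norm_fst_le[of "fst p" "snd p"] norm_snd_le[of "snd p" "fst p"] by simp
    finally show "norm (real_imag_sum J p) \<le> norm p * 2" .
  qed
qed

text \<open>The norm of the complexification is only prescribed on the range of \<open>J\<close>, so continuity of the
  real and imaginary part projections is not visible from the definitions; it comes from the
  bounded inverse theorem applied to \<open>(a, b) \<mapsto> J a + \<i> J b\<close>.\<close>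

lemma bounded_linear_complex_extension: "bounded_linear (complex_extension J l)"
proof -
  have "bij (real_imag_sum J)" using J by (simp add: complexification_def)
  then obtain C where C: "\<And>p. norm p \<le> C * norm (real_imag_sum J p)"
    using bounded_inverse[OF bounded_linear_real_imag_sum] by blast
  show ?thesis
  proof (rule bounded_linear_intro[where K = "norm l * (2 * C)"])
    fix x
    obtain a b where x: "x = J a + \<i> *\<^sub>C J b" by (rule complexification_cases)
    have "cmod (complex_extension J l x) \<le> \<bar>blinfun_apply l a\<bar> + \<bar>blinfun_apply l b\<bar>"
      unfolding x complex_extension_eq[OF J] by (rule order_trans[OF norm_triangle_ineq]) (simp add: norm_mult)
    also have "\<dots> \<le> norm l * norm a + norm l * norm b"
      using norm_blinfun[of l a] norm_blinfun[of l b] by simp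
    also have "\<dots> \<le> norm l * norm (a, b) + norm l * norm (a, b)"
      by (intro add_mono mult_left_mono norm_fst_le norm_snd_le) auto
    also have "\<dots> \<le> norm l * (2 * (C * norm x))"
      using mult_left_mono[OF C[of "(a, b)"], of "norm l"] by (simp add: x real_imag_sum_def)
    finally show "norm (complex_extension J l x) \<le> norm x * (norm l * (2 * C))"
      by (simp add: mult_ac)
  qed (auto simp: complex_extension_add complex_extension_scaleR)
qed

text \<open>The values of the functionals of the dual cone at \<open>x\<close> pairwise have nonnegative real inner
  product, so one rotation puts all of them into the first quadrant. By duality this says that
  the real and the imaginary part of the rotated vector lie in \<open>K\<close>.\<close>

lemma complexified_cone_rotation:
  assumes K: "real_cone K" and x: "x \<in> complexified_cone J K"
  obtains c u v where "u \<in> K" "v \<in> K" "x = c *\<^sub>C (J u + \<i> *\<^sub>C J v)"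
proof -
  have "0 \<le> Re (z * cnj w)" if "z \<in> (\<lambda>l. complex_extension J l x) ` dual_cone K"
    "w \<in> (\<lambda>l. complex_extension J l x) ` dual_cone K" for z w
    using x that by (auto simp: complexified_cone_def)
  then obtain \<theta> where \<theta>: "\<And>l. l \<in> dual_cone K \<Longrightarrow> 0 \<le> Re (cis \<theta> * complex_extension J l x)"
      "\<And>l. l \<in> dual_cone K \<Longrightarrow> 0 \<le> Im (cis \<theta> * complex_extension J l x)"
    by (rule rotation_into_first_quadrant) (auto simp del: times_complex.sel)
  obtain u v where uv: "cis \<theta> *\<^sub>C x = J u + \<i> *\<^sub>C J v" by (rule complexification_cases)
  have e: "cis \<theta> * complex_extension J l x = of_real (blinfun_apply l u) + \<i> * of_real (blinfun_apply l v)" for l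
    unfolding complex_extension_scaleC[symmetric] uv complex_extension_eq[OF J] ..
  have "u \<in> K" "v \<in> K"
    using \<theta> unfolding e by (auto intro!: dual_cone_separates[OF K])
  moreover have "x = cis (- \<theta>) *\<^sub>C (J u + \<i> *\<^sub>C J v)"
    by (simp flip: uv add: scaleC_scaleC cis_mult scaleC_one)
  ultimately show thesis by (rule that)
qed

text \<open>The dual counterpart: rotate the values of \<open>\<mu>\<close> on \<open>K\<close> into the first quadrant. Here the real and
  imaginary parts of the rotated functional are nonnegative on \<open>K\<close> by construction.\<close>

lemma complexified_dual_cone_rotation:
  assumes \<mu>: "\<mu> \<in> complexified_dual_cone J K"
  shows "\<exists>c. \<exists>m1\<in>dual_cone K. \<exists>m2\<in>dual_cone K. \<forall>x.
    blinfun_apply \<mu> x = c * (complex_extension J m1 x + \<i> * complex_extension J m2 x)"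
proof -
  interpret bounded_linear J by (rule bounded_linear_embedding)
  have dual: "\<mu> \<in> complex_dual" using \<mu> by (simp add: complexified_dual_cone_def)
  have "0 \<le> Re (z * cnj w)" if "z \<in> (\<lambda>k. blinfun_apply \<mu> (J k)) ` K"
    "w \<in> (\<lambda>k. blinfun_apply \<mu> (J k)) ` K" for z w
    using \<mu> that by (auto simp: complexified_dual_cone_def)
  then obtain \<theta> where \<theta>: "\<And>k. k \<in> K \<Longrightarrow> 0 \<le> Re (cis \<theta> * blinfun_apply \<mu> (J k))"
      "\<And>k. k \<in> K \<Longrightarrow> 0 \<le> Im (cis \<theta> * blinfun_apply \<mu> (J k))"
    by (rule rotation_into_first_quadrant) (auto simp del: times_complex.sel)
  have bl: "bounded_linear (\<lambda>a. cis \<theta> * blinfun_apply \<mu> (J a))"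
    by (intro bounded_linear_const_mult blinfun.bounded_linear_right
        bounded_linear_compose[OF blinfun.bounded_linear_right bounded_linear_embedding])
  define m1 where "m1 = Blinfun (\<lambda>a. Re (cis \<theta> * blinfun_apply \<mu> (J a)))"
  define m2 where "m2 = Blinfun (\<lambda>a. Im (cis \<theta> * blinfun_apply \<mu> (J a)))"
  have m1: "blinfun_apply m1 a = Re (cis \<theta> * blinfun_apply \<mu> (J a))" for a
    unfolding m1_def
    by (subst bounded_linear_Blinfun_apply[OF bounded_linear_compose[OF bounded_linear_Re bl]]) (rule refl)
  have m2: "blinfun_apply m2 a = Im (cis \<theta> * blinfun_apply \<mu> (J a))" for a
    unfolding m2_def
    by (subst bounded_linear_Blinfun_apply[OF bounded_linear_compose[OF bounded_linear_Im bl]]) (rule refl)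
  show ?thesis
  proof (rule exI[of _ "cis (- \<theta>)"], rule bexI[of _ m1], rule bexI[of _ m2], rule allI)
    show "m1 \<in> dual_cone K" "m2 \<in> dual_cone K"
      using \<theta> by (auto simp: dual_cone_def m1 m2 simp del: times_complex.sel)
    fix x
    obtain a b where x: "x = J a + \<i> *\<^sub>C J b" by (rule complexification_cases)
    have "complex_extension J m1 x + \<i> * complex_extension J m2 x =
        cis \<theta> * blinfun_apply \<mu> (J a) + \<i> * (cis \<theta> * blinfun_apply \<mu> (J b))"
      unfolding x complex_extension_eq[OF J] m1 m2 by (simp add: complex_eq_iff)
    also have "\<dots> = cis \<theta> * blinfun_apply \<mu> x"
      by (simp add: x blinfun.add_right complex_dual_scaleC[OF dual] algebra_simps)
    finally have "cis (- \<theta>) * (complex_extension J m1 x + \<i> * complex_extension J m2 x) =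
        cis (- \<theta>) * (cis \<theta> * blinfun_apply \<mu> x)" by simp
    also have "\<dots> = blinfun_apply \<mu> x" by (simp add: cis_mult flip: mult.assoc)
    finally show "blinfun_apply \<mu> x =
        cis (- \<theta>) * (complex_extension J m1 x + \<i> * complex_extension J m2 x)" ..
  qed
qed

lemma complexified_coneI:
  assumes "e1 \<in> K" "e2 \<in> K" and uv: "0 \<le> Re (u * cnj v)"
  shows "u *\<^sub>C J e1 + v *\<^sub>C J e2 \<in> complexified_cone J K"
  unfolding complexified_cone_def
proof (intro CollectI ballI)
  fix l1 l2 assume l: "l1 \<in> dual_cone K" "l2 \<in> dual_cone K"
  define p q p' q' where "p = blinfun_apply l1 e1" and "q = blinfun_apply l1 e2"
    and "p' = blinfun_apply l2 e1" and "q' = blinfun_apply l2 e2"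
  have nn: "0 \<le> p" "0 \<le> q" "0 \<le> p'" "0 \<le> q'"
    using l assms by (auto simp: dual_cone_def p_def q_def p'_def q'_def)
  have "Re ((of_real p * u + of_real q * v) * cnj (of_real p' * u + of_real q' * v)) =
      (cmod u)\<^sup>2 * (p * p') + (cmod v)\<^sup>2 * (q * q') + (p * q' + q * p') * Re (u * cnj v)"
    unfolding Re_image_mult_cnj by (simp add: algebra_simps)
  also have "\<dots> \<ge> 0" using nn uv by (intro add_nonneg_nonneg mult_nonneg_nonneg) auto
  finally show "0 \<le> Re (complex_extension J l1 (u *\<^sub>C J e1 + v *\<^sub>C J e2) *
      cnj (complex_extension J l2 (u *\<^sub>C J e1 + v *\<^sub>C J e2)))"
    by (simp only: complex_extension_add complex_extension_scaleC complex_extension_embedding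
        mult.commute p_def q_def p'_def q'_def)
qed

lemma complex_extension_in_dual_cone:
  assumes m: "m \<in> dual_cone K"
  obtains \<mu> where "\<mu> \<in> complexified_dual_cone J K" "blinfun_apply \<mu> = complex_extension J m"
proof
  have app: "blinfun_apply (Blinfun (complex_extension J m)) = complex_extension J m"
    by (rule bounded_linear_Blinfun_apply[OF bounded_linear_complex_extension])
  then show "blinfun_apply (Blinfun (complex_extension J m)) = complex_extension J m" .
  show "Blinfun (complex_extension J m) \<in> complexified_dual_cone J K"
    using m by (auto simp: complexified_dual_cone_def complex_operators_def app
        complex_extension_scaleC scaleC_complex_def complex_extension_embedding dual_cone_def)
qed

end

section \<open>From generating sets to test matrices over the whole cones\<close>

text \<open>The matrix entries are linear and continuous in each of their two arguments, so stability under
  nonnegative combinations of rows and under limits treats the vectors, and the same two facts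
  for columns treat the functionals. For the latter, weak-* approximation at the two points
  \<open>A (J1 e1)\<close> and \<open>A (J1 e2)\<close> is enough, because only they enter the matrix.\<close>

lemma gamma_plus_extends_to_cones:
  fixes J1 :: "'r1::banach \<Rightarrow> 'x1::complex_banach"
    and J2 :: "'r2::banach \<Rightarrow> 'x2::complex_banach"
  assumes J1: "complexification J1" and J2: "complexification J2"
    and E: "generating_set K1 E" and M: "weak_star_generating_set J2 K2 M"
    and g: "\<And>e1 e2 m1 m2. e1 \<in> E \<Longrightarrow> e2 \<in> E \<Longrightarrow> m1 \<in> M \<Longrightarrow> m2 \<in> M \<Longrightarrow>
      gamma_plus (complex_extension J2 m1 (blinfun_apply A (J1 e1)))
        (complex_extension J2 m2 (blinfun_apply A (J1 e1)))
        (complex_extension J2 m1 (blinfun_apply A (J1 e2)))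
        (complex_extension J2 m2 (blinfun_apply A (J1 e2)))"
    and "e1 \<in> K1" "e2 \<in> K1" "m1 \<in> dual_cone K2" "m2 \<in> dual_cone K2"
  shows "gamma_plus (complex_extension J2 m1 (blinfun_apply A (J1 e1)))
        (complex_extension J2 m2 (blinfun_apply A (J1 e1)))
        (complex_extension J2 m1 (blinfun_apply A (J1 e2)))
        (complex_extension J2 m2 (blinfun_apply A (J1 e2)))"
proof -
  define h where "h m e = complex_extension J2 m (blinfun_apply A (J1 e))" for m e
  have h: "bounded_linear (h m)" for m
    unfolding h_def
    by (intro bounded_linear_compose[OF bounded_linear_complex_extension[OF J2]]
        bounded_linear_compose[OF blinfun.bounded_linear_right] bounded_linear_embedding[OF J1])
  have h_sum: "h m (\<Sum>e\<in>F. t e *\<^sub>R e) = (\<Sum>e\<in>F. of_real (t e) * h m e)" for m F t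
    by (simp add: linear_sum[OF bounded_linear.linear[OF h]]
        linear_scale[OF bounded_linear.linear[OF h]] scaleR_conv_of_real)
  have h_sum_functionals: "h (\<Sum>m\<in>F. t m *\<^sub>R m) e = (\<Sum>m\<in>F. of_real (t m) * h m e)" for F t e
    unfolding h_def by (rule complex_extension_sum_functionals[OF J2])
  have comb: "gamma_plus (h m1 e1) (h m2 e1) (h m1 e2) (h m2 e2)"
    if m: "m1 \<in> M" "m2 \<in> M" and e: "e1 \<in> nonneg_combinations E" "e2 \<in> nonneg_combinations E" for m1 m2 e1 e2
  proof -
    obtain F s where F: "F \<subseteq> E" "\<And>e. e \<in> F \<Longrightarrow> 0 \<le> s e" "e1 = (\<Sum>e\<in>F. s e *\<^sub>R e)"
      using e(1) unfolding nonneg_combinations_def by auto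
    obtain G t where G: "G \<subseteq> E" "\<And>e. e \<in> G \<Longrightarrow> 0 \<le> t e" "e2 = (\<Sum>e\<in>G. t e *\<^sub>R e)"
      using e(2) unfolding nonneg_combinations_def by auto
    show ?thesis unfolding F(3) G(3) h_sum
      by (rule gamma_plus_sum_rows[where I = E])
        (use g m F(1,2) G(1,2) in \<open>auto simp: h_def\<close>)
  qed
  have cone: "gamma_plus (h m1 e1) (h m2 e1) (h m1 e2) (h m2 e2)"
    if "m1 \<in> M" "m2 \<in> M" "e1 \<in> K1" "e2 \<in> K1" for m1 m2 e1 e2
  proof -
    have K1: "K1 = closure (nonneg_combinations E)" using E by (simp add: generating_set_def)
    obtain s where s: "\<And>n. s n \<in> nonneg_combinations E" "s \<longlonglongrightarrow> e1"
      using \<open>e1 \<in> K1\<close> unfolding K1 closure_sequential by blast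
    obtain t where t: "\<And>n. t n \<in> nonneg_combinations E" "t \<longlonglongrightarrow> e2"
      using \<open>e2 \<in> K1\<close> unfolding K1 closure_sequential by blast
    show ?thesis
      by (rule gamma_plus_LIMSEQ[OF bounded_linear.tendsto[OF h s(2)] bounded_linear.tendsto[OF h s(2)]
          bounded_linear.tendsto[OF h t(2)] bounded_linear.tendsto[OF h t(2)]])
        (intro comb that s t)
  qed
  have dual_comb: "gamma_plus (h m1 e1) (h m2 e1) (h m1 e2) (h m2 e2)"
    if m: "m1 \<in> nonneg_combinations M" "m2 \<in> nonneg_combinations M" and e: "e1 \<in> K1" "e2 \<in> K1" for m1 m2 e1 e2
  proof -
    obtain F s where F: "F \<subseteq> M" "\<And>e. e \<in> F \<Longrightarrow> 0 \<le> s e" "m1 = (\<Sum>e\<in>F. s e *\<^sub>R e)"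
      using m(1) unfolding nonneg_combinations_def by auto
    obtain G t where G: "G \<subseteq> M" "\<And>e. e \<in> G \<Longrightarrow> 0 \<le> t e" "m2 = (\<Sum>e\<in>G. t e *\<^sub>R e)"
      using m(2) unfolding nonneg_combinations_def by auto
    have "gamma_plus (h m1 e1) (h m1 e2) (h m2 e1) (h m2 e2)" unfolding F(3) G(3) h_sum_functionals
      by (rule gamma_plus_sum_rows[where I = M])
        (use cone[THEN gamma_plus_transpose] e F(1,2) G(1,2) in auto)
    then show ?thesis by (rule gamma_plus_transpose)
  qed
  have approx: "\<exists>s. (\<forall>n. s n \<in> nonneg_combinations M) \<and>
      (\<lambda>n. h (s n) e1) \<longlonglongrightarrow> h m e1 \<and> (\<lambda>n. h (s n) e2) \<longlonglongrightarrow> h m e2"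
    if m: "m \<in> dual_cone K2" for m
  proof -
    have "\<exists>l\<in>nonneg_combinations M. cmod (h l e1 - h m e1) < 1 / real (Suc n) \<and>
        cmod (h l e2 - h m e2) < 1 / real (Suc n)" for n
    proof -
      have "\<forall>Y \<epsilon>. finite Y \<and> 0 < \<epsilon> \<longrightarrow> (\<exists>l\<in>nonneg_combinations M. \<forall>y\<in>Y.
          cmod (complex_extension J2 l y - complex_extension J2 m y) < \<epsilon>)"
        using M m unfolding weak_star_generating_set_def by blast
      from this[rule_format, of "{blinfun_apply A (J1 e1), blinfun_apply A (J1 e2)}" "1 / real (Suc n)"]
      show ?thesis by (simp add: h_def)
    qed
    then obtain s where s: "\<And>n. s n \<in> nonneg_combinations M"
        "\<And>n. cmod (h (s n) e1 - h m e1) < 1 / real (Suc n)"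
        "\<And>n. cmod (h (s n) e2 - h m e2) < 1 / real (Suc n)"
      by metis
    have lim: "z \<longlonglongrightarrow> w" if "\<And>n. cmod (z n - w) < 1 / real (Suc n)" for z w
    proof -
      have "(\<lambda>n. z n - w) \<longlonglongrightarrow> 0"
      proof (rule Lim_null_comparison[OF always_eventually])
        show "\<forall>n. norm (z n - w) \<le> 1 / real (Suc n)" using that less_imp_le by blast
        show "(\<lambda>n. 1 / real (Suc n)) \<longlonglongrightarrow> 0"
          using LIMSEQ_inverse_real_of_nat by (simp add: inverse_eq_divide)
      qed
      then show ?thesis by (simp add: LIM_zero_iff)
    qed
    show ?thesis
      by (rule exI[of _ s]) (simp only: s(1) lim[OF s(2)] lim[OF s(3)] simp_thms)
  qed
  obtain s where s: "\<And>n. s n \<in> nonneg_combinations M"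
      "(\<lambda>n. h (s n) e1) \<longlonglongrightarrow> h m1 e1" "(\<lambda>n. h (s n) e2) \<longlonglongrightarrow> h m1 e2"
    using approx[OF \<open>m1 \<in> dual_cone K2\<close>] by blast
  obtain t where t: "\<And>n. t n \<in> nonneg_combinations M"
      "(\<lambda>n. h (t n) e1) \<longlonglongrightarrow> h m2 e1" "(\<lambda>n. h (t n) e2) \<longlonglongrightarrow> h m2 e2"
    using approx[OF \<open>m2 \<in> dual_cone K2\<close>] by blast
  have "gamma_plus (h m1 e1) (h m2 e1) (h m1 e2) (h m2 e2)"
    by (rule gamma_plus_LIMSEQ[OF s(2) t(2) s(3) t(3)]) (intro dual_comb s t assms)
  then show ?thesis by (simp add: h_def)
qed

section \<open>Test matrices and invariance of the cones\<close>

lemma test_matrices_subset_iff: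
  "test_matrices J1 J2 E M A \<subseteq> Gamma_plus_closed \<longleftrightarrow>
    (\<forall>e1\<in>E. \<forall>e2\<in>E. \<forall>m1\<in>M. \<forall>m2\<in>M.
      gamma_plus (complex_extension J2 m1 (blinfun_apply A (J1 e1)))
        (complex_extension J2 m2 (blinfun_apply A (J1 e1)))
        (complex_extension J2 m1 (blinfun_apply A (J1 e2)))
        (complex_extension J2 m2 (blinfun_apply A (J1 e2))))"
  (is "?l \<longleftrightarrow> ?r")
proof
  assume sub: ?l
  show ?r
  proof (intro ballI)
    fix e1 e2 m1 m2 assume *: "e1 \<in> E" "e2 \<in> E" "m1 \<in> M" "m2 \<in> M"
    show "gamma_plus (complex_extension J2 m1 (blinfun_apply A (J1 e1)))
        (complex_extension J2 m2 (blinfun_apply A (J1 e1)))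
        (complex_extension J2 m1 (blinfun_apply A (J1 e2)))
        (complex_extension J2 m2 (blinfun_apply A (J1 e2)))"
      unfolding matrix2_in_Gamma_plus_closed[symmetric]
      by (rule subsetD[OF sub], unfold test_matrices_def mem_Collect_eq)
        (intro exI conjI, rule refl, use * in auto)
  qed
next
  assume ?r
  then show ?l by (auto simp: test_matrices_def matrix2_in_Gamma_plus_closed)
qed

lemma Re_common_factor: "Re ((c * z) * cnj (c * w)) = (cmod c)\<^sup>2 * Re (z * cnj w)"
proof -
  have "(c * z) * cnj (c * w) = of_real ((cmod c)\<^sup>2) * (z * cnj w)"
    unfolding complex_norm_square by (simp add: mult_ac)
  then show ?thesis by (simp only: Re_complex_of_real_times)
qed

theorem theorem2p7:
  fixes J1 :: "'r1::banach \<Rightarrow> 'x1::complex_banach"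
    and J2 :: "'r2::banach \<Rightarrow> 'x2::complex_banach"
    and K1 E1 :: "'r1 set"
    and K2 :: "'r2 set"
    and M2 :: "('r2 \<Rightarrow>\<^sub>L real) set"
    and A :: "'x1 \<Rightarrow>\<^sub>L 'x2"
  assumes "complexification J1" and "complexification J2"
    and "real_cone K1" and "real_cone K2"
    and "A \<in> complex_operators"
    and "generating_set K1 E1"
    and "weak_star_generating_set J2 K2 M2"
  shows "test_matrices J1 J2 E1 M2 A \<subseteq> Gamma_plus_closed \<longleftrightarrow>
    (blinfun_apply A ` complexified_cone J1 K1 \<subseteq> complexified_cone J2 K2 \<and>
     transposed A ` complexified_dual_cone J2 K2 \<subseteq> complexified_dual_cone J1 K1)"
proof -
  note J1 = assms(1) and J2 = assms(2) and K1 = assms(3) and A = complex_operator_scaleC[OF assms(5)]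
  note ext = complex_extension_add[OF J2] complex_extension_scaleC[OF J2]
  define h where "h m e = complex_extension J2 m (blinfun_apply A (J1 e))" for m e
  have test: "test_matrices J1 J2 E1 M2 A \<subseteq> Gamma_plus_closed \<longleftrightarrow>
      (\<forall>e1\<in>E1. \<forall>e2\<in>E1. \<forall>m1\<in>M2. \<forall>m2\<in>M2. gamma_plus (h m1 e1) (h m2 e1) (h m1 e2) (h m2 e2))"
    unfolding test_matrices_subset_iff h_def ..
  show ?thesis
  proof
    assume "test_matrices J1 J2 E1 M2 A \<subseteq> Gamma_plus_closed"
    note generators = this[unfolded test h_def, rule_format]
    have g: "gamma_plus (h m1 e1) (h m2 e1) (h m1 e2) (h m2 e2)"
      if "e1 \<in> K1" "e2 \<in> K1" "m1 \<in> dual_cone K2" "m2 \<in> dual_cone K2" for e1 e2 m1 m2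
      unfolding h_def
      by (rule gamma_plus_extends_to_cones[OF J1 J2 assms(6,7) generators that])
    have "blinfun_apply A x \<in> complexified_cone J2 K2" if x: "x \<in> complexified_cone J1 K1" for x
    proof -
      obtain c u v where uv: "u \<in> K1" "v \<in> K1" "x = c *\<^sub>C (J1 u + \<i> *\<^sub>C J1 v)"
        using complexified_cone_rotation[OF J1 K1 x] by blast
      \<comment> \<open>a test matrix, transposed, applied to \<open>(1, \<i>)\<close>; the scalar \<open>c\<close> only contributes \<open>|c|\<^sup>2\<close>\<close>
      have e: "complex_extension J2 l (blinfun_apply A x) = c * (h l u * 1 + h l v * \<i>)" for l
        by (simp add: uv(3) A blinfun.add_right ext h_def mult.commute)
      show ?thesis
        unfolding complexified_cone_def mem_Collect_eq e Re_common_factor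
      proof (intro ballI mult_nonneg_nonneg)
        fix l1 l2 assume "l1 \<in> dual_cone K2" "l2 \<in> dual_cone K2"
        then have "gamma_plus (h l1 u) (h l1 v) (h l2 u) (h l2 v)"
          by (rule gamma_plus_transpose[OF g[OF uv(1,2)]])
        then show "0 \<le> Re ((h l1 u * 1 + h l1 v * \<i>) * cnj (h l2 u * 1 + h l2 v * \<i>))"
          by (rule gamma_plus_preserves) simp
      qed simp
    qed
    moreover have "transposed A \<mu> \<in> complexified_dual_cone J1 K1"
      if \<mu>: "\<mu> \<in> complexified_dual_cone J2 K2" for \<mu>
    proof -
      have "\<mu> \<in> complex_dual" using \<mu> by (simp add: complexified_dual_cone_def)
      then have dual: "transposed A \<mu> \<in> complex_dual"
        by (simp add: complex_operators_def transposed_def A)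
      obtain c m1 m2 where m: "m1 \<in> dual_cone K2" "m2 \<in> dual_cone K2"
          "\<forall>x. blinfun_apply \<mu> x = c * (complex_extension J2 m1 x + \<i> * complex_extension J2 m2 x)"
        using complexified_dual_cone_rotation[OF J2 \<mu>] by blast
      \<comment> \<open>likewise a test matrix applied to \<open>(1, \<i>)\<close>\<close>
      have e: "blinfun_apply (transposed A \<mu>) (J1 k) = c * (h m1 k * 1 + h m2 k * \<i>)" for k
        by (simp add: transposed_def m(3) h_def mult.commute)
      show ?thesis
        unfolding complexified_dual_cone_def mem_Collect_eq e Re_common_factor
      proof (intro conjI ballI mult_nonneg_nonneg dual)
        fix k1 k2 assume "k1 \<in> K1" "k2 \<in> K1"
        then have "gamma_plus (h m1 k1) (h m2 k1) (h m1 k2) (h m2 k2)" using g m by blast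
        then show "0 \<le> Re ((h m1 k1 * 1 + h m2 k1 * \<i>) * cnj (h m1 k2 * 1 + h m2 k2 * \<i>))"
          by (rule gamma_plus_preserves) simp
      qed simp
    qed
    ultimately show "blinfun_apply A ` complexified_cone J1 K1 \<subseteq> complexified_cone J2 K2 \<and>
        transposed A ` complexified_dual_cone J2 K2 \<subseteq> complexified_dual_cone J1 K1"
      by blast
  next
    assume incl: "blinfun_apply A ` complexified_cone J1 K1 \<subseteq> complexified_cone J2 K2 \<and>
        transposed A ` complexified_dual_cone J2 K2 \<subseteq> complexified_dual_cone J1 K1"
    have sub: "E1 \<subseteq> K1" "M2 \<subseteq> dual_cone K2"
      using assms(6,7) by (auto simp: generating_set_def weak_star_generating_set_def)
    \<comment> \<open>The inclusion of the dual cones is applied to the real functional \<open>m\<close>.\<close>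
    have row: "0 \<le> Re (h m e1 * cnj (h m e2))" if m: "m \<in> dual_cone K2" and e: "e1 \<in> K1" "e2 \<in> K1" for m e1 e2
    proof -
      obtain \<mu> where \<mu>: "\<mu> \<in> complexified_dual_cone J2 K2" "blinfun_apply \<mu> = complex_extension J2 m"
        using complex_extension_in_dual_cone[OF J2 m] by blast
      then have "transposed A \<mu> \<in> complexified_dual_cone J1 K1" using incl by blast
      then have "0 \<le> Re (blinfun_apply (transposed A \<mu>) (J1 e1) * cnj (blinfun_apply (transposed A \<mu>) (J1 e2)))"
        using e unfolding complexified_dual_cone_def by blast
      then show ?thesis by (simp add: transposed_def \<mu>(2) h_def)
    qed
    show "test_matrices J1 J2 E1 M2 A \<subseteq> Gamma_plus_closed"
      unfolding test
    proof (intro ballI)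
      fix e1 e2 m1 m2 assume "e1 \<in> E1" "e2 \<in> E1" "m1 \<in> M2" "m2 \<in> M2"
      then have e: "e1 \<in> K1" "e2 \<in> K1" and m: "m1 \<in> dual_cone K2" "m2 \<in> dual_cone K2"
        using sub by auto
      \<comment> \<open>The image under \<open>A\<close> of \<open>u e1 + v e2\<close> gives the invariance condition for the transposed matrix.\<close>
      have "gamma_plus (h m1 e1) (h m1 e2) (h m2 e1) (h m2 e2)"
      proof (rule gamma_plusI)
        fix u v :: complex assume "0 \<le> Re (u * cnj v)"
        then have "blinfun_apply A (u *\<^sub>C J1 e1 + v *\<^sub>C J1 e2) \<in> complexified_cone J2 K2"
          using incl complexified_coneI[OF J1 e] by blast
        then have "0 \<le> Re (complex_extension J2 m1 (blinfun_apply A (u *\<^sub>C J1 e1 + v *\<^sub>C J1 e2)) *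
            cnj (complex_extension J2 m2 (blinfun_apply A (u *\<^sub>C J1 e1 + v *\<^sub>C J1 e2))))"
          using m unfolding complexified_cone_def by blast
        then show "0 \<le> Re ((h m1 e1 * u + h m1 e2 * v) * cnj (h m2 e1 * u + h m2 e2 * v))"
          by (simp only: A blinfun.add_right ext h_def mult.commute[of u] mult.commute[of v])
      qed (use row e m in auto)
      then show "gamma_plus (h m1 e1) (h m2 e1) (h m1 e2) (h m2 e2)"
        by (rule gamma_plus_transpose)
    qed
  qed
qed

end
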